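(* Let $a>0$ be an integer. 1. For each $n\ge0$ and each $\Lambda_n\in\mathcal F_n$, $$\lim_{p\to\infty}\frac{\mathbb E[\mathbf 1_{\Lambda_n\cap\{S^*_p<a\}}]}{\mathbb E[\mathbf 1_{\{S^*_p<a\}}]}=\mathbb E[\mathbf 1_{\Lambda_n\cap\{S^*_n<a\}}M_n],$$ where $M_n:=\mathbf 1_{\{S^*_n<a\}}\left(\cos\frac{\pi}{2a}\right)^{-n}\sin\left(\frac{\pi(a-X_n)}{2a}\right)$, and $(M_n,n\ge0)$ is a positive $(\mathcal F_n)$-martingale under $\mathbb P$ which is not uniformly integrable. 2. Let $Q$ be the probability on $(\Omega,\mathcal F_\infty)$ characterized by $Q(\Lambda_n)=\mathbb E[\mathbf 1_{\Lambda_n}M_n]$ for all $n\in\mathbb N$, $\Lambda_n\in\mathcal F_n$. Under $Q$, $(X_n,n\ge0)$ has the following transition probabilities, for $-a+1\le k\le a-1$: $$Q(X_{n+1}=k+1\mid X_n=k)=\frac{\sin\left(\frac{a-k-1}{2a}\pi\right)}{2\cos\left(\frac{\pi}{2a}\right)\sin\left(\frac{a-k}{2a}\pi\right)},\qquad Q(X_{n+1}=k-1\mid X_n=k)=\frac{\sin\left(\frac{a-k+1}{2a}\pi\right)}{2\cos\left(\frac{\pi}{2a}\right)\sin\left(\frac{a-k}{2a}\pi\right)}.$$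
   Context: $\mathbb N=\{0,1,2,\dots\}$. $\Omega$ is the set of paths $\omega:\mathbb N\to\mathbb Z$ with $|\omega(n+1)-\omega(n)|=1$; $X=(X_n)_{n\ge0}$ is the coordinate process, $\mathcal F_n=\sigma(X_0,\dots,X_n)$, $\mathcal F_\infty=\bigvee_n\mathcal F_n$. $\mathbb P=\mathbb P_0$ is the law under which $X$ is the simple symmetric random walk on $\mathbb Z$ started from $0$, with expectation $\mathbb E$. $S^*_n:=\max_{0\le k\le n}|X_k|$. "Positive" means nonnegative. Conditional probabilities are considered when the conditioning event has positive $Q$-probability.
   Formalization: The integer a is assumed to be at least 2; for a = 1 the statement is ill-defined, since cos(π/(2a)) = 0 makes M_n and the transition probabilities undefined and the ratio in part 1 is 0/0. *)

theory Defs
  imports "HOL-Probability.Probability"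
begin

definition paths :: "(nat \<Rightarrow> int) set" where
  "paths = {\<omega>. \<forall>n. \<bar>\<omega> (Suc n) - \<omega> n\<bar> = 1}"

definition X :: "nat \<Rightarrow> (nat \<Rightarrow> int) \<Rightarrow> int" where
  "X n \<omega> = \<omega> n"

definition F :: "nat \<Rightarrow> (nat \<Rightarrow> int) measure" where
  "F n = sigma paths {X k -` B \<inter> paths | k B. k \<le> n}"

definition F_inf :: "(nat \<Rightarrow> int) measure" where
  "F_inf = sigma paths (\<Union>n. sets (F n))"

text \<open>The measure \<open>srw\<close> is the law on \<open>paths\<close> of the partial sums of a sequence of
  independent steps, each uniform on \<open>{-1, 1}\<close>.\<close>

definition srw :: "(nat \<Rightarrow> int) measure" where
  "srw = distr (\<Pi>\<^sub>M i\<in>(UNIV :: nat set). uniform_count_measure {-1, 1 :: int}) F_inf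
           (\<lambda>\<xi> n. \<Sum>k<n. \<xi> k)"

definition S_star :: "nat \<Rightarrow> (nat \<Rightarrow> int) \<Rightarrow> int" where
  "S_star n \<omega> = Max ((\<lambda>k. \<bar>X k \<omega>\<bar>) ` {0..n})"

definition M :: "int \<Rightarrow> nat \<Rightarrow> (nat \<Rightarrow> int) \<Rightarrow> real" where
  "M a n \<omega> = indicator {\<omega> \<in> paths. S_star n \<omega> < a} \<omega>
     * cos (pi / (2 * real_of_int a)) powi (- int n)
     * sin (pi * real_of_int (a - X n \<omega>) / (2 * real_of_int a))"

definition martingale ::
  "'a measure \<Rightarrow> (nat \<Rightarrow> 'a measure) \<Rightarrow> (nat \<Rightarrow> 'a \<Rightarrow> real) \<Rightarrow> bool" where
  "martingale N G Y \<longleftrightarrow>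
     (\<forall>n. subalgebra N (G n)) \<and> filtration (space N) G \<and>
     (\<forall>n. Y n \<in> borel_measurable (G n)) \<and> (\<forall>n. integrable N (Y n)) \<and>
     (\<forall>m n. m \<le> n \<longrightarrow> (AE \<omega> in N. real_cond_exp N (G m) (Y n) \<omega> = Y m \<omega>))"

text \<open>The supremum is taken in \<open>ennreal\<close>, where it is the true supremum even for a family
  that is not bounded in \<open>L\<^sup>1\<close>.\<close>

definition uniformly_integrable :: "'a measure \<Rightarrow> ('i \<Rightarrow> 'a \<Rightarrow> real) \<Rightarrow> bool" where
  "uniformly_integrable N Y \<longleftrightarrow>
     (\<forall>i. Y i \<in> borel_measurable N) \<and>
     ((\<lambda>K :: real. SUP i. \<integral>\<^sup>+\<omega>. ennreal \<bar>Y i \<omega>\<bar> * indicator {\<omega>. K \<le> \<bar>Y i \<omega>\<bar>} \<omega> \<partial>N)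
        \<longlongrightarrow> 0) at_top"

text \<open>\<open>Q_law a Q\<close> states that \<open>Q\<close> is a probability measure on \<open>F_inf\<close> whose restriction to
  each \<open>F n\<close> has density \<open>M a n\<close> with respect to \<open>srw\<close>.\<close>

definition Q_law :: "int \<Rightarrow> (nat \<Rightarrow> int) measure \<Rightarrow> bool" where
  "Q_law a Q \<longleftrightarrow> prob_space Q \<and> sets Q = sets F_inf \<and>
     (\<forall>n. \<forall>\<Lambda> \<in> sets (F n). measure Q \<Lambda> = (\<integral>\<omega>. indicator \<Lambda> \<omega> * M a n \<omega> \<partial>srw))"

lemma space_F [simp]: "space (F n) = paths"
  unfolding F_def by (rule space_measure_of) auto

lemma sets_F: "sets (F n) = sigma_sets paths {X k -` B \<inter> paths | k B. k \<le> n}"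
  unfolding F_def by (rule sets_measure_of) auto

lemma space_F_inf [simp]: "space F_inf = paths"
  unfolding F_inf_def by (rule space_measure_of) (use sets.space_closed in fastforce)

lemma sets_F_inf: "sets F_inf = sigma_sets paths (\<Union>n. sets (F n))"
  unfolding F_inf_def by (rule sets_measure_of) (use sets.space_closed in fastforce)

lemma sets_F_le_F_inf: "sets (F n) \<subseteq> sets F_inf"
  unfolding sets_F_inf by auto

lemma filtration_F: "filtration paths F"
proof
  fix i j :: nat assume "i \<le> j"
  then show "sets (F i) \<le> sets (F j)"
    unfolding sets_F by (intro sigma_sets_mono') (auto intro: order_trans)
qed simp

lemma sets_F_inf': "sets F_inf = sigma_sets paths {X k -` B \<inter> paths | k B. True}"
  (is "_ = sigma_sets _ ?G")
proof (intro subset_antisym)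
  have "sets (F n) \<subseteq> sigma_sets paths ?G" for n
    unfolding sets_F by (intro sigma_sets_mono') auto
  then show "sets F_inf \<subseteq> sigma_sets paths ?G"
    unfolding sets_F_inf by (intro sigma_sets_mono) auto
  have "?G \<subseteq> (\<Union>n. sets (F n))"
    unfolding sets_F by (auto intro!: sigma_sets.Basic)
  then show "sigma_sets paths ?G \<subseteq> sets F_inf"
    unfolding sets_F_inf by (intro sigma_sets_mono') auto
qed

lemma measurable_partial_sums:
  "(\<lambda>\<xi> n. \<Sum>k<n. \<xi> k) \<in> (\<Pi>\<^sub>M i\<in>(UNIV :: nat set). uniform_count_measure {-1, 1 :: int}) \<rightarrow>\<^sub>M F_inf"
  (is "?f \<in> ?P \<rightarrow>\<^sub>M _")
proof -
  have meas: "(\<lambda>\<xi>. \<Sum>k<n. \<xi> k) \<in> ?P \<rightarrow>\<^sub>M count_space UNIV" for n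
  proof -
    have c: "(\<lambda>\<xi>. \<xi> k) \<in> ?P \<rightarrow>\<^sub>M count_space UNIV" for k
    proof -
      have "(\<lambda>\<xi>. \<xi> k) \<in> ?P \<rightarrow>\<^sub>M uniform_count_measure {-1, 1 :: int}"
        by (rule measurable_component_singleton) simp
      moreover have "(\<lambda>x. x) \<in> uniform_count_measure {-1, 1 :: int} \<rightarrow>\<^sub>M count_space UNIV"
        by (auto simp: measurable_def space_uniform_count_measure sets_uniform_count_measure)
      ultimately show ?thesis by (rule measurable_compose)
    qed
    show ?thesis
    proof (induction n)
      case (Suc n)
      have "(\<lambda>\<xi>. (\<Sum>k<n. \<xi> k) + \<xi> n) \<in> ?P \<rightarrow>\<^sub>M count_space UNIV"
      proof (rule measurable_compose_countable[where f="\<lambda>s \<xi>. s + \<xi> n", OF _ Suc])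
        show "(\<lambda>\<xi>. s + \<xi> n) \<in> ?P \<rightarrow>\<^sub>M count_space UNIV" for s
          by (rule measurable_compose[OF c]) simp
      qed
      then show ?case by simp
    qed simp
  qed
  have sp: "?f \<in> space ?P \<rightarrow> paths"
  proof
    fix \<xi> assume "\<xi> \<in> space ?P"
    then have "\<xi> n \<in> {-1, 1}" for n
      by (auto simp: space_PiM space_uniform_count_measure PiE_iff)
    then have "\<bar>\<xi> n\<bar> = 1" for n
      by (metis abs_minus_cancel abs_one insertE singletonD)
    then show "?f \<xi> \<in> paths"
      by (simp add: paths_def)
  qed
  show ?thesis
  proof (rule measurable_sigma_sets[OF sets_F_inf'])
    fix A assume "A \<in> {X k -` B \<inter> paths | k B. True}"
    then obtain k B where A: "A = X k -` B \<inter> paths" by auto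
    then have "?f -` A \<inter> space ?P = (\<lambda>\<xi>. \<Sum>i<k. \<xi> i) -` B \<inter> space ?P"
      using sp by (auto simp: X_def)
    also have "\<dots> \<in> sets ?P" by (rule measurable_sets[OF meas]) simp
    finally show "?f -` A \<inter> space ?P \<in> sets ?P" .
  qed (use sp in auto)
qed

lemma space_srw [simp]: "space srw = paths"
  and sets_srw [simp, measurable_cong]: "sets srw = sets F_inf"
  by (simp_all add: srw_def)

lemma prob_space_srw: "prob_space srw"
proof -
  interpret product_prob_space "\<lambda>_. uniform_count_measure {-1, 1 :: int}" "UNIV :: nat set"
    by (intro product_prob_spaceI prob_space_uniform_count_measure) auto
  show ?thesis
    unfolding srw_def by (intro prob_space_distr measurable_partial_sums)
qed

end

(* Write h(x) = sin(pi (a - x) / 2a) and c = cos(pi / 2a). The function h vanishes at -a and a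
   and is an eigenfunction, with eigenvalue c, of the one-step averaging operator killed outside
   (-a, a); this makes M a martingale. The survival probability g_m(x), i.e. the probability of
   staying in (-a, a) for m steps from x, solves the same killed heat equation as c^m h(x), so an
   inequality b c^m h \<le> g_m \<le> B c^m h persists in time, and since every site reaches every other
   site of the same parity in 2a steps, the gap B - b shrinks geometrically. By the Markov property
   the conditional probabilities are integrals of g_{p-n}(X_n) / g_p(0), which therefore tend to
   h(X_n) / c^n. As E[M_n] = 1 but P(S*_n < a) = g_n(0) tends to 0, all the mass of M_n sits at
   arbitrarily large values, so M is not uniformly integrable. Q is the law of the Markov chain
   obtained from the walk by the h-transform, driven by independent uniform variables; it agrees
   with the density M_n on the countably many atoms of F_n. *)
theory Submission
  imports Defs
begin

section \<open>The path filtration and its atoms\<close>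

lemma measurable_X_F: "k \<le> n \<Longrightarrow> X k \<in> F n \<rightarrow>\<^sub>M count_space UNIV"
  by (rule measurableI) (auto simp: sets_F intro!: sigma_sets.Basic)

lemma subalgebra_F: "subalgebra srw (F n)"
  using sets_F_le_F_inf by (auto simp: subalgebra_def)

lemma measurable_X_F_inf [measurable]: "X k \<in> F_inf \<rightarrow>\<^sub>M count_space UNIV"
  by (rule measurableI) (auto simp: sets_F_inf' intro!: sigma_sets.Basic)

lemma X_eq_in_sets_F: "k \<le> n \<Longrightarrow> {\<omega> \<in> paths. X k \<omega> = x} \<in> sets (F n)"
  using measurable_sets[OF measurable_X_F, of k n "{x}"] by (simp add: vimage_def Int_def conj_commute)

text \<open>The generators of \<open>F n\<close> read only coordinates up to \<open>n\<close>, and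
  this survives complements and countable unions.\<close>

lemma sets_F_determined:
  assumes "\<Lambda> \<in> sets (F n)" "\<omega> \<in> paths" "\<omega>' \<in> paths" "\<And>k. k \<le> n \<Longrightarrow> \<omega> k = \<omega>' k"
  shows "\<omega> \<in> \<Lambda> \<longleftrightarrow> \<omega>' \<in> \<Lambda>"
  using assms(1) unfolding sets_F
  by (induction rule: sigma_sets.induct) (use assms(2-) in \<open>auto simp: X_def\<close>)

lemma measurable_into_F_inf:
  assumes "\<And>n. (\<lambda>\<xi>. T \<xi> n) \<in> N \<rightarrow>\<^sub>M count_space UNIV" "T \<in> space N \<rightarrow> paths"
  shows "T \<in> N \<rightarrow>\<^sub>M F_inf"
proof (rule measurable_sigma_sets[OF sets_F_inf'])
  fix A assume "A \<in> {X k -` B \<inter> paths | k B. True}"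
  then obtain k B where A: "A = X k -` B \<inter> paths" by auto
  then have "T -` A \<inter> space N = (\<lambda>\<xi>. T \<xi> k) -` B \<inter> space N"
    using assms(2) by (auto simp: X_def)
  also have "\<dots> \<in> sets N" by (rule measurable_sets[OF assms(1)]) simp
  finally show "T -` A \<inter> space N \<in> sets N" .
qed (use assms(2) in auto)

lemma sets_F_mono: "m \<le> n \<Longrightarrow> \<Lambda> \<in> sets (F m) \<Longrightarrow> \<Lambda> \<in> sets (F n)"
  using filtration.sets_F_mono[OF filtration_F] by blast

lemma sets_F_srw: "\<Lambda> \<in> sets (F n) \<Longrightarrow> \<Lambda> \<in> sets srw"
  using sets_F_le_F_inf by auto

lemma sets_F_subset_paths: "\<Lambda> \<in> sets (F n) \<Longrightarrow> \<Lambda> \<subseteq> paths"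
  using sets.sets_into_space by fastforce

lemma paths_in_sets_F: "paths \<in> sets (F n)"
  using sets.top[of "F n"] by simp

lemma X_Suc_cases:
  assumes "\<omega> \<in> paths" shows "X (Suc n) \<omega> = X n \<omega> + 1 \<or> X (Suc n) \<omega> = X n \<omega> + (- 1)"
proof -
  have "\<bar>X (Suc n) \<omega> - X n \<omega>\<bar> = 1" using assms by (simp add: paths_def X_def)
  then show ?thesis by linarith
qed

text \<open>The events of all the \<open>F n\<close> form a pi-system that generates
  \<open>F_inf\<close>; this yields the uniqueness of \<open>Q\<close>.\<close>

lemma measure_eqI_F:
  assumes N: "finite_measure N" "finite_measure N'" "sets N = sets F_inf" "sets N' = sets F_inf"
    and eq: "\<And>n \<Lambda>. \<Lambda> \<in> sets (F n) \<Longrightarrow> measure N \<Lambda> = measure N' \<Lambda>"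
  shows "N = N'"
proof (rule measure_eqI_generator_eq[where E="\<Union>n. sets (F n)" and \<Omega>=paths and A="\<lambda>_. paths"])
  show "Int_stable (\<Union>n. sets (F n))"
  proof (rule Int_stableI)
    fix A B assume "A \<in> (\<Union>n. sets (F n))" "B \<in> (\<Union>n. sets (F n))"
    then obtain m n where "A \<in> sets (F m)" "B \<in> sets (F n)" by auto
    then have "A \<inter> B \<in> sets (F (max m n))"
      using sets_F_mono[of m "max m n" A] sets_F_mono[of n "max m n" B] by auto
    then show "A \<inter> B \<in> (\<Union>n. sets (F n))" by blast
  qed
  show "(\<Union>n. sets (F n)) \<subseteq> Pow paths" using sets_F_subset_paths by auto
  show "emeasure N \<Lambda> = emeasure N' \<Lambda>" if "\<Lambda> \<in> (\<Union>n. sets (F n))" for \<Lambda>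
    using that eq by (auto simp: finite_measure.emeasure_eq_measure N)
  show "range (\<lambda>_. paths) \<subseteq> (\<Union>n. sets (F n))" using paths_in_sets_F by auto
qed (use N in \<open>auto simp: sets_F_inf finite_measure.emeasure_finite\<close>)

text \<open>\<open>w\<close> may be any function, since only its values up to \<open>n\<close>
  matter; lists take its place when the atoms are counted.\<close>

definition atom :: "nat \<Rightarrow> (nat \<Rightarrow> int) \<Rightarrow> (nat \<Rightarrow> int) set" where
  "atom n w = {\<omega> \<in> paths. \<forall>k\<le>n. X k \<omega> = X k w}"

lemma sets_atom: "atom n w \<in> sets (F n)"
proof -
  have "(\<Inter>k\<in>{..n}. {\<omega> \<in> paths. X k \<omega> = X k w}) \<in> sets (F n)"
    using X_eq_in_sets_F by (intro sets.finite_INT) auto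
  also have "(\<Inter>k\<in>{..n}. {\<omega> \<in> paths. X k \<omega> = X k w}) = atom n w"
    by (auto simp: atom_def)
  finally show ?thesis .
qed

text \<open>Every event of \<open>F n\<close> is a disjoint union of atoms, of which there are only
  countably many, so countable additivity suffices.\<close>

lemma emeasure_eqI_atoms:
  assumes N: "sets N = sets F_inf" "sets N' = sets F_inf"
    and eq: "\<And>w. w \<in> paths \<Longrightarrow> emeasure N (atom n w) = emeasure N' (atom n w)"
    and \<Lambda>: "\<Lambda> \<in> sets (F n)"
  shows "emeasure N \<Lambda> = emeasure N' \<Lambda>"
proof -
  note sub = sets_F_subset_paths[OF \<Lambda>]
  have atom_F_inf: "atom n w \<in> sets F_inf" for w
    using sets_atom sets_F_le_F_inf by blast
  \<comment> \<open>An atom is fixed by the list of its first \<open>n + 1\<close> values, and lists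
    of integers are countable.\<close>
  have "atom n w = atom n (\<lambda>k. map w [0..<Suc n] ! k)" for w
    by (auto simp: atom_def X_def nth_map_upt simp del: upt_Suc)
  then have "atom n ` \<Lambda> \<subseteq> range (\<lambda>l. atom n (\<lambda>k. l ! k))" by blast
  then have count: "countable (atom n ` \<Lambda>)" by (rule countable_subset) auto
  have disj: "disjoint_family_on (\<lambda>A. A) (atom n ` \<Lambda>)"
    by (auto simp: disjoint_family_on_def atom_def)
  have un: "(\<Union>A\<in>atom n ` \<Lambda>. A) = \<Lambda>"
    using sub sets_F_determined[OF \<Lambda>] by (auto simp: atom_def X_def)
  have "emeasure N (\<Union>A\<in>atom n ` \<Lambda>. A) = (\<integral>\<^sup>+A. emeasure N A \<partial>count_space (atom n ` \<Lambda>))"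
    using N atom_F_inf by (intro emeasure_UN_countable count disj) auto
  also have "\<dots> = (\<integral>\<^sup>+A. emeasure N' A \<partial>count_space (atom n ` \<Lambda>))"
    using eq sub by (intro nn_integral_cong) auto
  also have "\<dots> = emeasure N' (\<Union>A\<in>atom n ` \<Lambda>. A)"
    using N atom_F_inf by (intro emeasure_UN_countable[symmetric] count disj) auto
  finally show ?thesis unfolding un .
qed

text \<open>The left sides have the shape in which \<open>measure_law_step\<close> and
  \<open>measure_srw_step\<close> produce them, for the increment of \<open>w\<close>
  itself.\<close>

lemma atom_Suc:
  "{\<omega> \<in> atom n w. X n \<omega> = X n w \<and> X (Suc n) \<omega> = X n w + (X (Suc n) w - X n w)} = atom (Suc n) w"
  "{\<omega> \<in> atom n w. X n \<omega> = X n w} = atom n w"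
  by (auto simp: atom_def le_Suc_eq)

lemma measure_atom_0:
  assumes N: "prob_space N" "sets N = sets F_inf" and start: "AE \<omega> in N. X 0 \<omega> = 0"
  shows "measure N (atom 0 w) = (if X 0 w = 0 then 1 else 0)"
proof -
  interpret prob_space N by (rule N)
  have sp: "space N = paths" using sets_eq_imp_space_eq[OF N(2)] by simp
  have A: "atom 0 w \<in> events" using N(2) sets_atom sets_F_le_F_inf by blast
  show ?thesis
  proof (cases "X 0 w = 0")
    case True
    have "AE \<omega> in N. \<omega> \<in> atom 0 w"
      using start AE_space by eventually_elim (simp add: atom_def sp True)
    then show ?thesis using True A by (simp add: prob_eq_1)
  next
    case False
    have "AE \<omega> in N. \<omega> \<notin> atom 0 w"
      using start by eventually_elim (use False in \<open>simp add: atom_def\<close>)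
    then show ?thesis using False A by (simp add: prob_eq_0)
  qed
qed

section \<open>Walks with site-dependent step distributions\<close>

text \<open>One independent noise value drives each step, and \<open>s x\<close> turns it into the
  step taken at site \<open>x\<close>. The simple walk and the h-transformed walk are both
  instances, so the Markov property is proved once.\<close>

locale walk = prob_space K for K :: "'k measure" +
  fixes s :: "int \<Rightarrow> 'k \<Rightarrow> int"
  assumes measurable_step [measurable]: "s x \<in> K \<rightarrow>\<^sub>M count_space UNIV"
    and step_values: "e \<in> space K \<Longrightarrow> s x e \<in> {-1, 1}"
begin

primrec position :: "(nat \<Rightarrow> 'k) \<Rightarrow> nat \<Rightarrow> int" where
  "position \<xi> 0 = 0"
| "position \<xi> (Suc n) = position \<xi> n + s (position \<xi> n) (\<xi> n)"

abbreviation noise :: "(nat \<Rightarrow> 'k) measure" where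
  "noise \<equiv> \<Pi>\<^sub>M i\<in>UNIV. K"

definition law :: "(nat \<Rightarrow> int) measure" where
  "law = distr noise F_inf position"

sublocale noise: product_prob_space "\<lambda>_. K" "UNIV :: nat set"
  by unfold_locales

lemma position_cong: "(\<And>i. i < n \<Longrightarrow> \<xi> i = \<xi>' i) \<Longrightarrow> position \<xi> n = position \<xi>' n"
  by (induction n) auto

lemma measurable_position: "(\<lambda>\<xi>. position \<xi> n) \<in> noise \<rightarrow>\<^sub>M count_space UNIV"
proof (induction n)
  case (Suc n)
  \<comment> \<open>The step map is chosen by a random site; as the integers are countable,
    measurability for each fixed site is enough.\<close>
  have "(\<lambda>\<xi>. position \<xi> n + s (position \<xi> n) (\<xi> n)) \<in> noise \<rightarrow>\<^sub>M count_space UNIV"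
    by (rule measurable_compose_countable[where f="\<lambda>x \<xi>. x + s x (\<xi> n)", OF _ Suc]) measurable
  then show ?case by simp
qed simp

lemma position_in_paths: "\<xi> \<in> space noise \<Longrightarrow> position \<xi> \<in> paths"
proof -
  assume "\<xi> \<in> space noise"
  then have "s x (\<xi> n) \<in> {-1, 1}" for x n
    by (intro step_values) (auto simp: space_PiM)
  then have "\<bar>s x (\<xi> n)\<bar> = 1" for x n
    by (metis abs_minus_cancel abs_one insertE singletonD)
  then show ?thesis by (simp add: paths_def)
qed

lemma measurable_position_F_inf: "position \<in> noise \<rightarrow>\<^sub>M F_inf"
  using measurable_position position_in_paths by (intro measurable_into_F_inf) auto

lemma prob_space_law: "prob_space law"
  unfolding law_def by (intro noise.prob_space_distr measurable_position_F_inf)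

lemma sets_law [simp, measurable_cong]: "sets law = sets F_inf"
  and space_law [simp]: "space law = paths"
  by (simp_all add: law_def)

lemma measure_law:
  "\<Lambda> \<in> sets F_inf \<Longrightarrow> measure law \<Lambda> = measure noise {\<xi> \<in> space noise. position \<xi> \<in> \<Lambda>}"
  unfolding law_def
  by (subst measure_distr[OF measurable_position_F_inf])
    (auto simp: vimage_def Int_def conj_commute)

lemma indep_vars_noise: "noise.indep_vars (\<lambda>_. K) (\<lambda>i \<xi>. \<xi> i) UNIV"
proof (subst noise.indep_vars_iff_distr_eq_PiM')
  have "distr noise K (\<lambda>\<xi>. \<xi> i) = K" for i
    by (rule distr_PiM_component) (auto intro: prob_space_axioms)
  then show "distr noise noise (\<lambda>\<xi>. \<lambda>i\<in>UNIV. \<xi> i) = (\<Pi>\<^sub>M i\<in>UNIV. distr noise K (\<lambda>\<xi>. \<xi> i))"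
    by (simp add: restrict_UNIV)
qed auto

text \<open>An event of \<open>F n\<close> only reads the noise before time \<open>n\<close>, which is independent of the
  noise at time \<open>n\<close>.\<close>

lemma measure_past_and_present:
  assumes \<Lambda>: "\<Lambda> \<in> sets (F n)" and D: "D \<in> sets K"
  shows "measure noise {\<xi> \<in> space noise. position \<xi> \<in> \<Lambda> \<and> \<xi> n \<in> D}
    = measure noise {\<xi> \<in> space noise. position \<xi> \<in> \<Lambda>} * prob D"
proof -
  obtain e where e: "e \<in> space K" using not_empty by auto
  let ?past = "\<lambda>\<xi>. restrict (\<lambda>i. \<xi> i) {..<n} :: nat \<Rightarrow> 'k"
  let ?present = "\<lambda>\<xi>. restrict (\<lambda>i. \<xi> i) {n} :: nat \<Rightarrow> 'k"
  \<comment> \<open>Completes a finite stretch of noise by the constant \<open>e\<close>. Positions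
    up to time \<open>n\<close> do not see the filler, so an event of \<open>F n\<close> becomes a
    measurable condition on the first \<open>n\<close> noise values.\<close>
  define ext where "ext \<xi> = (\<lambda>i. if i < n then \<xi> i else e)" for \<xi> :: "nat \<Rightarrow> 'k"
  have ext: "ext \<in> PiM {..<n} (\<lambda>_. K) \<rightarrow>\<^sub>M noise"
    unfolding ext_def
  proof (rule measurable_PiM_single')
    show "(\<lambda>\<omega>. if i < n then \<omega> i else e) \<in> Pi\<^sub>M {..<n} (\<lambda>_. K) \<rightarrow>\<^sub>M K" for i
      by (cases "i < n") (simp_all add: e)
  qed (auto simp: space_PiM e PiE_iff)
  define P where "P = (\<lambda>\<xi>. position (ext \<xi>)) -` \<Lambda> \<inter> space (PiM {..<n} (\<lambda>_. K))"
  define R where "R = (\<lambda>\<xi>. \<xi> n) -` D \<inter> space (PiM {n} (\<lambda>_. K))"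
  have "\<Lambda> \<in> sets F_inf" using \<Lambda> sets_F_le_F_inf by auto
  then have P: "P \<in> sets (PiM {..<n} (\<lambda>_. K))"
    unfolding P_def by (rule measurable_sets[OF measurable_compose[OF ext measurable_position_F_inf]])
  have R: "R \<in> sets (PiM {n} (\<lambda>_. K))"
    unfolding R_def by (rule measurable_sets[OF _ D]) simp
  have "noise.indep_var (PiM {..<n} (\<lambda>_. K)) ?past (PiM {n} (\<lambda>_. K)) ?present"
    by (rule noise.indep_var_restrict[OF indep_vars_noise]) auto
  from noise.indep_varD[OF this P R]
  have *: "measure noise ((\<lambda>\<xi>. (?past \<xi>, ?present \<xi>)) -` (P \<times> R) \<inter> space noise)
    = measure noise (?past -` P \<inter> space noise) * measure noise (?present -` R \<inter> space noise)" .
  have past: "?past \<xi> \<in> P \<longleftrightarrow> position \<xi> \<in> \<Lambda>" if \<xi>: "\<xi> \<in> space noise" for \<xi>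
  proof -
    have sp: "?past \<xi> \<in> space (PiM {..<n} (\<lambda>_. K))" using \<xi> by (auto simp: space_PiM)
    have "position (ext (?past \<xi>)) \<in> paths"
      using measurable_space[OF ext sp] by (rule position_in_paths)
    then have "position (ext (?past \<xi>)) \<in> \<Lambda> \<longleftrightarrow> position \<xi> \<in> \<Lambda>"
      using position_in_paths[OF \<xi>]
      by (intro sets_F_determined[OF \<Lambda>] position_cong) (auto simp: ext_def)
    then show ?thesis using sp by (simp add: P_def)
  qed
  have present: "?present \<xi> \<in> R \<longleftrightarrow> \<xi> n \<in> D" if "\<xi> \<in> space noise" for \<xi>
    using that by (auto simp: R_def space_PiM)
  have "measure noise (?present -` R \<inter> space noise) = measure (distr noise K (\<lambda>\<xi>. \<xi> n)) D"
    using present D by (subst measure_distr) (auto intro!: arg_cong[where f="measure noise"])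
  also have "distr noise K (\<lambda>\<xi>. \<xi> n) = K"
    by (rule distr_PiM_component) (auto intro: prob_space_axioms)
  finally have "measure noise (?present -` R \<inter> space noise) = prob D" .
  moreover have "(\<lambda>\<xi>. (?past \<xi>, ?present \<xi>)) -` (P \<times> R) \<inter> space noise
      = {\<xi> \<in> space noise. position \<xi> \<in> \<Lambda> \<and> \<xi> n \<in> D}"
    using past present by auto
  moreover have "?past -` P \<inter> space noise = {\<xi> \<in> space noise. position \<xi> \<in> \<Lambda>}"
    using past by auto
  ultimately show ?thesis using * by simp
qed

text \<open>Once the site is fixed to \<open>k\<close>, the step at time \<open>n\<close> is the
  fixed function \<open>s k\<close> of the noise at time \<open>n\<close>, which is independent of
  \<open>\<Lambda>\<close> and of \<open>X n\<close>.\<close>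

lemma measure_law_step:
  assumes \<Lambda>: "\<Lambda> \<in> sets (F n)"
  shows "measure law {\<omega> \<in> \<Lambda>. X n \<omega> = k \<and> X (Suc n) \<omega> = k + d}
    = measure law {\<omega> \<in> \<Lambda>. X n \<omega> = k} * \<P>(e in K. s k e = d)"
proof -
  have sub: "\<Lambda> \<subseteq> paths" using sets.sets_into_space[OF \<Lambda>] by simp
  have "{\<omega> \<in> \<Lambda>. X n \<omega> = k} = \<Lambda> \<inter> {\<omega> \<in> paths. X n \<omega> = k}" using sub by auto
  then have now: "{\<omega> \<in> \<Lambda>. X n \<omega> = k} \<in> sets (F n)"
    using \<Lambda> X_eq_in_sets_F[of n n k] by auto
  have "{\<omega> \<in> \<Lambda>. X n \<omega> = k \<and> X (Suc n) \<omega> = k + d}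
      = {\<omega> \<in> \<Lambda>. X n \<omega> = k} \<inter> {\<omega> \<in> paths. X (Suc n) \<omega> = k + d}" using sub by auto
  then have both: "{\<omega> \<in> \<Lambda>. X n \<omega> = k \<and> X (Suc n) \<omega> = k + d} \<in> sets F_inf"
    using now X_eq_in_sets_F[of "Suc n" "Suc n" "k + d"] sets_F_le_F_inf by auto
  have D: "{e \<in> space K. s k e = d} \<in> sets K" by measurable
  have "{\<xi> \<in> space noise. position \<xi> \<in> {\<omega> \<in> \<Lambda>. X n \<omega> = k \<and> X (Suc n) \<omega> = k + d}}
      = {\<xi> \<in> space noise. position \<xi> \<in> {\<omega> \<in> \<Lambda>. X n \<omega> = k} \<and> \<xi> n \<in> {e \<in> space K. s k e = d}}"
    by (auto simp: X_def space_PiM)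
  moreover have "{\<omega> \<in> \<Lambda>. X n \<omega> = k} \<in> sets F_inf" using now sets_F_le_F_inf by auto
  ultimately show ?thesis
    using both by (simp only: measure_law measure_past_and_present[OF now D])
qed

lemma AE_law_start: "AE \<omega> in law. X 0 \<omega> = 0"
  unfolding law_def using X_eq_in_sets_F[of 0 0 0] sets_F_le_F_inf[of 0]
  by (subst AE_distr_iff[OF measurable_position_F_inf]) (auto simp: X_def)

end

section \<open>The killed heat equation\<close>

text \<open>Here \<open>m\<close> counts the steps still to go, so this is the backward equation of
  the walk; killing is encoded by the value 0 on all outside sites.\<close>

definition killed_heat :: "int \<Rightarrow> (nat \<Rightarrow> int \<Rightarrow> real) \<Rightarrow> bool" where
  "killed_heat a f \<longleftrightarrow>
     (\<forall>m x. \<bar>x\<bar> < a \<longrightarrow> f (Suc m) x = (f m (x + 1) + f m (x - 1)) / 2) \<and>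
     (\<forall>m x. a \<le> \<bar>x\<bar> \<longrightarrow> f m x = 0)"

text \<open>The probability of staying inside for \<open>m\<close> more steps from \<open>x\<close>,
  as a recursion; \<open>measure_alive\<close> makes the link with the walk.\<close>

fun survival :: "int \<Rightarrow> nat \<Rightarrow> int \<Rightarrow> real" where
  "survival a 0 x = (if \<bar>x\<bar> < a then 1 else 0)"
| "survival a (Suc m) x =
     (if \<bar>x\<bar> < a then (survival a m (x + 1) + survival a m (x - 1)) / 2 else 0)"

definition eigval :: "int \<Rightarrow> real" where
  "eigval a = cos (pi / (2 * real_of_int a))"

text \<open>Cut off to 0 outside so as to satisfy the killing condition; the sine itself already
  vanishes at \<open>a\<close> and \<open>- a\<close>.\<close>

definition eigfun :: "int \<Rightarrow> int \<Rightarrow> real" where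
  "eigfun a x = (if \<bar>x\<bar> < a then sin (pi * real_of_int (a - x) / (2 * real_of_int a)) else 0)"

lemma killed_heat_survival: "killed_heat a (survival a)"
  unfolding killed_heat_def
proof (intro conjI allI impI)
  fix m x show "a \<le> \<bar>x\<bar> \<Longrightarrow> survival a m x = 0" by (cases m) auto
qed auto

lemma killed_heat_diff:
  "killed_heat a f \<Longrightarrow> killed_heat a g \<Longrightarrow> killed_heat a (\<lambda>m x. f m x - g m x)"
  by (auto simp: killed_heat_def field_simps)

lemma killed_heat_scale: "killed_heat a f \<Longrightarrow> killed_heat a (\<lambda>m x. r * f m x)"
  by (auto simp: killed_heat_def field_simps)

section \<open>Trigonometric eigenfunction of the killed walk\<close>

context
  fixes a :: int
  assumes a: "a \<ge> 2"
begin

text \<open>\<open>a \<ge> 2\<close> puts the angle strictly between 0 and pi / 2; for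
  \<open>a = 1\<close> the eigenvalue would be 0, and its powers serve as denominators.\<close>

lemma eigval_pos: "0 < eigval a" and eigval_less_1: "eigval a < 1"
proof -
  have r: "real_of_int a \<ge> 2" using a by linarith
  have "pi / (2 * real_of_int a) < pi / 2" using r by (simp add: field_simps)
  moreover have "0 < pi / (2 * real_of_int a)" using r by simp
  moreover have "pi / 2 \<le> pi" by simp
  ultimately show "0 < eigval a" "eigval a < 1"
    using cos_monotone_0_pi[of 0 "pi / (2 * real_of_int a)"]
      cos_gt_zero_pi[of "pi / (2 * real_of_int a)"]
    unfolding eigval_def cos_zero by linarith+
qed

text \<open>The neighbours of an interior site lie in the closed interval, where the cut-off changes
  nothing, so the addition formulas for the sine apply to them.\<close>

lemma eigfun_eq:
  assumes "\<bar>x\<bar> \<le> a"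
  shows "eigfun a x = sin (pi * real_of_int (a - x) / (2 * real_of_int a))"
proof (cases "\<bar>x\<bar> < a")
  case False
  then have "x = a \<or> x = - a" using assms by linarith
  then show ?thesis using a by (auto simp: eigfun_def)
qed (simp add: eigfun_def)

lemma eigfun_pos: "\<bar>x\<bar> < a \<Longrightarrow> 0 < eigfun a x"
proof -
  assume x: "\<bar>x\<bar> < a"
  then have "0 < real_of_int (a - x)" "real_of_int (a - x) < 2 * real_of_int a" by linarith+
  then have "0 < sin (pi * real_of_int (a - x) / (2 * real_of_int a))"
    using a by (intro sin_gt_zero divide_pos_pos mult_pos_pos) (simp_all add: divide_less_eq)
  then show ?thesis using x by (simp add: eigfun_def)
qed

lemma eigfun_nonneg: "0 \<le> eigfun a x"
  using eigfun_pos[of x] by (cases "\<bar>x\<bar> < a") (auto simp: eigfun_def)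

lemma eigfun_le_1: "eigfun a x \<le> 1"
  by (simp add: eigfun_def)

lemma eigfun_0: "eigfun a 0 = 1"
  using a by (simp add: eigfun_def)

lemma eigfun_step:
  assumes "\<bar>x\<bar> < a"
  shows "eigfun a (x + 1) + eigfun a (x - 1) = 2 * eigval a * eigfun a x"
proof -
  let ?A = "pi * real_of_int (a - x) / (2 * real_of_int a)" and ?t = "pi / (2 * real_of_int a)"
  have "eigfun a (x + 1) = sin (?A - ?t)" "eigfun a (x - 1) = sin (?A + ?t)"
    using assms a by (auto simp: eigfun_eq field_simps intro!: arg_cong[where f=sin])
  then show ?thesis
    using assms by (simp add: eigfun_eq eigval_def sin_add sin_diff)
qed

lemma killed_heat_eigfun: "killed_heat a (\<lambda>m x. eigval a ^ m * eigfun a x)"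
  unfolding killed_heat_def
proof (intro conjI allI impI)
  fix m and x :: int assume "\<bar>x\<bar> < a"
  then have "(eigval a ^ m * eigfun a (x + 1) + eigval a ^ m * eigfun a (x - 1)) / 2
     = eigval a ^ m * (2 * eigval a * eigfun a x) / 2"
    by (simp only: eigfun_step[symmetric] distrib_left)
  then show "eigval a ^ Suc m * eigfun a x
     = (eigval a ^ m * eigfun a (x + 1) + eigval a ^ m * eigfun a (x - 1)) / 2" by simp
qed (auto simp: eigfun_def)

section \<open>Comparison and spreading of solutions\<close>

text \<open>The walk has period 2, so bounds propagate only along the sites \<open>x\<close> with \<open>x + m\<close> of a
  fixed parity at time \<open>m\<close>.\<close>

lemma killed_heat_nonneg:
  assumes f: "killed_heat a f"
    and nonneg: "\<And>x. even (x + int m + e) \<Longrightarrow> 0 \<le> f m x"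
  shows "even (x + int (m + j) + e) \<Longrightarrow> 0 \<le> f (m + j) x"
proof (induction j arbitrary: x)
  case (Suc j)
  show ?case
  proof (cases "\<bar>x\<bar> < a")
    case True
    have "0 \<le> f (m + j) (x + 1)" "0 \<le> f (m + j) (x - 1)"
      using Suc.prems by (auto intro!: Suc.IH)
    moreover have "f (Suc (m + j)) x = (f (m + j) (x + 1) + f (m + j) (x - 1)) / 2"
      using f True unfolding killed_heat_def by blast
    ultimately show ?thesis by simp
  next
    case False
    then show ?thesis using f by (simp add: killed_heat_def)
  qed
qed (use nonneg in simp)

text \<open>Some nearest-neighbour path of \<open>j\<close> steps leads from \<open>x\<close> to
  \<open>y\<close> inside the interval; it alone has weight \<open>1 / 2 ^ j\<close>, and all other
  paths contribute nonnegative amounts.\<close>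

lemma killed_heat_lower_bound:
  assumes f: "killed_heat a f"
    and nonneg: "\<And>x. even (x + int m + e) \<Longrightarrow> 0 \<le> f m x"
    and y: "\<bar>y\<bar> < a" "even (y + int m + e)"
  shows "\<bar>x\<bar> < a \<Longrightarrow> even (x + int (m + j) + e) \<Longrightarrow> \<bar>x - y\<bar> \<le> int j \<Longrightarrow>
    f m y / 2 ^ j \<le> f (m + j) x"
proof (induction j arbitrary: x)
  case (Suc j)
  \<comment> \<open>A neighbour inside the interval from which \<open>y\<close> remains within reach
    of \<open>j\<close> steps.\<close>
  obtain d where d: "d = 1 \<or> d = -1" "\<bar>x + d\<bar> < a" "\<bar>x + d - y\<bar> \<le> int j"
  proof -
    consider "x < y" | "x > y" | "x = y" "x < a - 1" | "x = y" "x = a - 1"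
      using Suc.prems(1) by linarith
    then show thesis
    proof cases
      case 1 then show thesis using that[of 1] Suc.prems y by auto
    next
      case 2 then show thesis using that[of "-1"] Suc.prems y by auto
    next
      case 3
      \<comment> \<open>With \<open>x = y\<close>, parity makes \<open>Suc j\<close> even, so
        \<open>j > 0\<close> and a detour away from \<open>y\<close> can still return.\<close>
      then have "0 < j" using Suc.prems y by (cases j) auto
      then show thesis using that[of 1] 3 Suc.prems by auto
    next
      case 4
      then have "0 < j" using Suc.prems y by (cases j) auto
      then show thesis using that[of "-1"] 4 Suc.prems a by auto
    qed
  qed
  have par: "even (x + d + int (m + j) + e)" "even (x - d + int (m + j) + e)"
    using Suc.prems(2) d(1) by auto
  have "f m y / 2 ^ j \<le> f (m + j) (x + d)"
    using Suc.IH[OF d(2) par(1) d(3)] .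
  moreover have "0 \<le> f (m + j) (x - d)"
    using killed_heat_nonneg[OF f nonneg par(2)] by blast
  moreover have "f (m + Suc j) x = (f (m + j) (x + d) + f (m + j) (x - d)) / 2"
    using f Suc.prems(1) d(1) by (auto simp: killed_heat_def)
  ultimately show ?case by simp
qed (use y in simp)

text \<open>Interior sites are less than \<open>2 * a\<close> apart, and an even number of steps
  preserves parity. The factor \<open>eigfun a x\<close>, at most 1, makes the bound comparable with
  the eigenfunction solution and true outside as well.\<close>

lemma killed_heat_mixing:
  assumes f: "killed_heat a f"
    and nonneg: "\<And>x. even (x + int m + e) \<Longrightarrow> 0 \<le> f m x"
    and y: "\<bar>y\<bar> < a" "even (y + int m + e)"
    and x: "even (x + int m + e)"
  shows "f m y * eigfun a x / 2 ^ nat (2 * a) \<le> f (m + nat (2 * a)) x"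
proof (cases "\<bar>x\<bar> < a")
  case True
  have "f m y * eigfun a x \<le> f m y * 1"
    using nonneg[OF y(2)] eigfun_le_1 by (intro mult_left_mono) auto
  then have "f m y * eigfun a x / 2 ^ nat (2 * a) \<le> f m y / 2 ^ nat (2 * a)"
    by (simp add: divide_right_mono)
  also have "\<dots> \<le> f (m + nat (2 * a)) x"
    using True x y a by (intro killed_heat_lower_bound[OF f nonneg]) auto
  finally show ?thesis .
next
  case False
  then show ?thesis using f by (simp add: killed_heat_def eigfun_def)
qed

section \<open>Squeezing survival probabilities between eigenfunction solutions\<close>

definition sandwiched :: "nat \<Rightarrow> int \<Rightarrow> real \<Rightarrow> real \<Rightarrow> bool" where
  "sandwiched m e b B \<longleftrightarrow> (\<forall>x. even (x + int m + e) \<longrightarrow>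
     b * (eigval a ^ m * eigfun a x) \<le> survival a m x \<and>
     survival a m x \<le> B * (eigval a ^ m * eigfun a x))"

text \<open>The equation is linear, so survival minus the lower bound and the upper bound minus
  survival are solutions, and their nonnegativity persists.\<close>

lemma sandwiched_mono:
  assumes "sandwiched m e b B"
  shows "sandwiched (m + j) e b B"
proof -
  note L = killed_heat_diff[OF killed_heat_survival killed_heat_scale[OF killed_heat_eigfun, of b]]
  note U = killed_heat_diff[OF killed_heat_scale[OF killed_heat_eigfun, of B] killed_heat_survival]
  show ?thesis
    using assms killed_heat_nonneg[OF L, of m e _ j] killed_heat_nonneg[OF U, of m e _ j]
    unfolding sandwiched_def by auto
qed

lemma sandwiched_start:
  obtains B where "1 \<le> B" "\<And>e. sandwiched 0 e 1 B"
proof -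
  \<comment> \<open>The sum dominates each \<open>1 / eigfun a x\<close>, as the upper bound at time
    0 requires; the lower constant 1 works because \<open>eigfun\<close> is at most 1.\<close>
  define B where "B = (\<Sum>x | \<bar>x\<bar> < a. 1 / eigfun a x)"
  have fin: "finite {x. \<bar>x\<bar> < a}"
    by (rule finite_subset[of _ "{-a..a}"]) auto
  have ge: "1 / eigfun a x \<le> B" if "\<bar>x\<bar> < a" for x
    unfolding B_def using fin that
    by (intro member_le_sum) (auto simp: eigfun_nonneg)
  have "1 \<le> B" using ge[of 0] a by (simp add: eigfun_0)
  moreover have "sandwiched 0 e 1 B" for e
    unfolding sandwiched_def
  proof (intro allI impI)
    fix x
    show "1 * (eigval a ^ 0 * eigfun a x) \<le> survival a 0 x \<and>
        survival a 0 x \<le> B * (eigval a ^ 0 * eigfun a x)"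
    proof (cases "\<bar>x\<bar> < a")
      case True
      then show ?thesis
        using ge[OF True] eigfun_pos[OF True] eigfun_le_1[of x] by (simp add: divide_le_eq)
    qed (simp add: eigfun_def)
  qed
  ultimately show thesis by (rule that)
qed

lemma survival_bounds:
  obtains B where "1 \<le> B" "\<And>m x. eigval a ^ m * eigfun a x \<le> survival a m x"
    "\<And>m x. survival a m x \<le> B * (eigval a ^ m * eigfun a x)"
proof -
  obtain B where B: "1 \<le> B" "\<And>e. sandwiched 0 e 1 B" by (rule sandwiched_start) blast
  \<comment> \<open>Choosing \<open>e = x + int m\<close> fulfils the parity condition at
    \<open>x\<close>, so the bounds hold at all sites and times.\<close>
  have "eigval a ^ m * eigfun a x \<le> survival a m x \<and>
      survival a m x \<le> B * (eigval a ^ m * eigfun a x)" for m x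
    using sandwiched_mono[OF B(2)[of "x + int m"], of m] by (simp add: sandwiched_def)
  then show thesis using that B(1) by blast
qed

text \<open>The power of 2 is the weight of a single path of \<open>2 * a\<close> steps; the factor
  \<open>eigval a\<close> is a lower bound for \<open>eigfun\<close> at the reference site in
  \<open>sandwiched_contract\<close>.\<close>

definition mixing_rate :: real where
  "mixing_rate = eigval a / 2 ^ nat (2 * a)"

lemma mixing_rate: "0 < mixing_rate" "mixing_rate \<le> 1"
proof -
  show "0 < mixing_rate" using eigval_pos by (simp add: mixing_rate_def)
  have "eigval a * 1 \<le> 1 * 2 ^ nat (2 * a)" using eigval_less_1 eigval_pos by (intro mult_mono) auto
  then show "mixing_rate \<le> 1" by (simp add: mixing_rate_def)
qed

text \<open>Both gaps of the sandwich are nonnegative solutions of the killed heat equation, so each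
  of them spreads from one site \<open>y\<close> to all sites; the two gaps at \<open>y\<close> add up to \<open>B - b\<close>.\<close>

lemma sandwiched_contract:
  assumes sw: "sandwiched m e b B"
  obtains b' B' where "b \<le> b'" "B' \<le> B" "B' - b' = (1 - mixing_rate) * (B - b)"
    "sandwiched (m + nat (2 * a)) e b' B'"
proof -
  let ?c = "eigval a" and ?h = "eigfun a" and ?g = "survival a" and ?L = "nat (2 * a)"
  \<comment> \<open>The reference site: 0 or 1, according to parity.\<close>
  define y where "y = (if even (int m + e) then 0 else 1 :: int)"
  have y: "\<bar>y\<bar> < a" "even (y + int m + e)" using a by (auto simp: y_def)
  \<comment> \<open>The eigenvalue equation at 0 and the symmetry of the sine give
    \<open>eigfun a 1 = eigval a\<close>.\<close>
  have "2 * eigval a * eigfun a 0 = eigfun a (0 + 1) + eigfun a (0 - 1)"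
    using a by (simp only: eigfun_step)
  moreover have "eigfun a (- 1) = eigfun a 1"
    using a sin_diff[of pi "pi * (a - 1) / (2 * a)"]
    by (auto simp: eigfun_def field_simps)
  ultimately have "?h y = 1 \<or> ?h y = ?c" by (auto simp: y_def eigfun_0)
  then have hy: "?c \<le> ?h y" "0 < ?h y" using eigval_less_1 eigval_pos by auto
  \<comment> \<open>The ratio at \<open>y\<close>; there the two gaps are exactly
    \<open>r - b\<close> and \<open>B - r\<close> times the eigenfunction solution.\<close>
  define r where "r = ?g m y / (?c ^ m * ?h y)"
  have cm: "0 < ?c ^ n" for n using eigval_pos by simp
  have r: "?g m y = r * (?c ^ m * ?h y)" using eigval_pos hy by (simp add: r_def)
  have br: "b \<le> r" "r \<le> B"
    using sw y(2) cm[of m] hy unfolding sandwiched_def r_def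
    by (auto simp: field_simps)
  \<comment> \<open>To be applied to both gaps: what a nonnegative solution has at \<open>y\<close>,
    measured in units of the eigenfunction solution, reaches every site of the right parity after
    \<open>2 * a\<close> steps, up to the factor \<open>mixing_rate\<close>.\<close>
  have key: "mixing_rate * t * (?c ^ (m + ?L) * ?h x) \<le> f (m + ?L) x"
    if f: "killed_heat a f" and nn: "\<And>x. even (x + int m + e) \<Longrightarrow> 0 \<le> f m x"
      and t: "0 \<le> t" "f m y = t * (?c ^ m * ?h y)" and x: "even (x + int m + e)" for f t x
  proof -
    have "?c * ?c ^ ?L \<le> ?h y * 1"
      using hy eigval_pos eigval_less_1 by (intro mult_mono) (auto intro!: power_le_one)
    then have "(?c * ?c ^ ?L) * (t * ?c ^ m * ?h x / 2 ^ ?L) \<le> ?h y * 1 * (t * ?c ^ m * ?h x / 2 ^ ?L)"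
      using t cm[of m] eigfun_nonneg[of x] by (intro mult_right_mono) auto
    also have "\<dots> = f m y * ?h x / 2 ^ ?L" by (simp add: t(2))
    also have "\<dots> \<le> f (m + ?L) x" by (rule killed_heat_mixing[OF f nn y x])
    finally show ?thesis by (simp add: mixing_rate_def power_add mult_ac)
  qed
  note L = killed_heat_diff[OF killed_heat_survival killed_heat_scale[OF killed_heat_eigfun, of b]]
  note U = killed_heat_diff[OF killed_heat_scale[OF killed_heat_eigfun, of B] killed_heat_survival]
  show thesis
  \<comment> \<open>The two improvements add up to \<open>mixing_rate * (B - b)\<close>, whatever
    the value of \<open>r\<close>.\<close>
  proof (rule that[of "b + mixing_rate * (r - b)" "B - mixing_rate * (B - r)"])
    show "sandwiched (m + ?L) e (b + mixing_rate * (r - b)) (B - mixing_rate * (B - r))"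
      unfolding sandwiched_def
    proof (intro allI impI)
      fix x assume "even (x + int (m + ?L) + e)"
      then have x: "even (x + int m + e)" using a by auto
      have "mixing_rate * (r - b) * (?c ^ (m + ?L) * ?h x)
          \<le> ?g (m + ?L) x - b * (?c ^ (m + ?L) * ?h x)"
        using sw br by (intro key[OF L _ _ _ x]) (auto simp: sandwiched_def r left_diff_distrib)
      moreover have "mixing_rate * (B - r) * (?c ^ (m + ?L) * ?h x)
          \<le> B * (?c ^ (m + ?L) * ?h x) - ?g (m + ?L) x"
        using sw br by (intro key[OF U _ _ _ x]) (auto simp: sandwiched_def r left_diff_distrib)
      ultimately show "(b + mixing_rate * (r - b)) * (?c ^ (m + ?L) * ?h x) \<le> ?g (m + ?L) x \<and>
          ?g (m + ?L) x \<le> (B - mixing_rate * (B - r)) * (?c ^ (m + ?L) * ?h x)"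
        by (simp add: algebra_simps)
    qed
  qed (use br mixing_rate in \<open>auto simp: algebra_simps\<close>)
qed

lemma sandwiched_iterate:
  assumes "sandwiched 0 e 1 B"
  shows "\<exists>b' B'. 1 \<le> b' \<and> B' - b' = (1 - mixing_rate) ^ j * (B - 1) \<and>
    sandwiched (j * nat (2 * a)) e b' B'"
proof (induction j)
  case 0
  then show ?case using assms by (intro exI[of _ 1] exI[of _ B]) auto
next
  case (Suc j)
  then obtain b1 B1 where *: "1 \<le> b1" "B1 - b1 = (1 - mixing_rate) ^ j * (B - 1)"
    "sandwiched (j * nat (2 * a)) e b1 B1" by blast
  from sandwiched_contract[OF *(3)] obtain b2 B2 where "b1 \<le> b2"
    "B2 - b2 = (1 - mixing_rate) * (B1 - b1)" "sandwiched (j * nat (2 * a) + nat (2 * a)) e b2 B2"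
    by blast
  then show ?case using * by (intro exI[of _ b2] exI[of _ B2]) (auto simp: add.commute)
qed

text \<open>The threshold is uniform in \<open>e\<close> because \<open>sandwiched_start\<close>
  provides one \<open>B\<close> for both parities.\<close>

lemma sandwiched_eventually:
  assumes "0 < \<epsilon>"
  shows "\<exists>m0. \<forall>m\<ge>m0. \<forall>e. \<exists>b B. 1 \<le> b \<and> B - b < \<epsilon> \<and> sandwiched m e b B"
proof -
  obtain B where B: "1 \<le> B" "\<And>e. sandwiched 0 e 1 B" by (rule sandwiched_start) blast
  have "(\<lambda>j. (1 - mixing_rate) ^ j * (B - 1)) \<longlonglongrightarrow> 0 * (B - 1)"
    using mixing_rate by (intro tendsto_intros LIMSEQ_realpow_zero) auto
  then have "eventually (\<lambda>j. (1 - mixing_rate) ^ j * (B - 1) < \<epsilon>) sequentially"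
    using assms by (auto dest: order_tendstoD(2))
  then obtain j where j: "(1 - mixing_rate) ^ j * (B - 1) < \<epsilon>"
    by (auto simp: eventually_sequentially)
  have "\<exists>b' B'. 1 \<le> b' \<and> B' - b' < \<epsilon> \<and> sandwiched m e b' B'" if "j * nat (2 * a) \<le> m" for m e
  proof -
    obtain b' B' where *: "1 \<le> b'" "B' - b' = (1 - mixing_rate) ^ j * (B - 1)"
      "sandwiched (j * nat (2 * a)) e b' B'"
      using sandwiched_iterate[OF B(2)[of e], of j] by blast
    moreover have "sandwiched m e b' B'"
      using sandwiched_mono[OF *(3), of "m - j * nat (2 * a)"] that by simp
    ultimately show ?thesis using j by (intro exI[of _ b'] exI[of _ B']) auto
  qed
  then show ?thesis by blast
qed

section \<open>Limits of survival probabilities\<close>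

lemma survival_ratio_tendsto:
  assumes "even (x + int n)"
  shows "(\<lambda>m. survival a m x / survival a (n + m) 0) \<longlonglongrightarrow> eigfun a x / eigval a ^ n"
proof (rule LIMSEQ_I)
  fix \<epsilon> :: real assume \<epsilon>: "0 < \<epsilon>"
  let ?c = "eigval a" and ?h = "eigfun a" and ?g = "survival a"
  have cp: "0 < ?c ^ i" for i using eigval_pos by simp
  \<comment> \<open>The tolerance is scaled because the error is finally divided by
    \<open>eigval a ^ n\<close>.\<close>
  from sandwiched_eventually[of "\<epsilon> * ?c ^ n"] \<epsilon> cp[of n] obtain m0 where
    m0: "\<forall>m\<ge>m0. \<forall>e. \<exists>b B. 1 \<le> b \<and> B - b < \<epsilon> * ?c ^ n \<and> sandwiched m e b B" by auto
  show "\<exists>m0. \<forall>m\<ge>m0. norm (?g m x / ?g (n + m) 0 - ?h x / ?c ^ n) < \<epsilon>"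
  proof (intro exI[of _ m0] allI impI)
    fix m assume "m0 \<le> m"
    \<comment> \<open>With parity \<open>int (n + m)\<close>, site \<open>x\<close> is admissible at
      time \<open>m\<close> and site 0 at time \<open>n + m\<close>, so the same \<open>b\<close>
      and \<open>B\<close> control numerator and denominator.\<close>
    with m0 obtain b B where bB: "1 \<le> b" "B - b < \<epsilon> * ?c ^ n" "sandwiched m (int (n + m)) b B"
      by blast
    have x: "b * (?c ^ m * ?h x) \<le> ?g m x" "?g m x \<le> B * (?c ^ m * ?h x)"
      using bB(3) assms by (auto simp: sandwiched_def)
    have z: "b * ?c ^ (n + m) \<le> ?g (n + m) 0" "?g (n + m) 0 \<le> B * ?c ^ (n + m)"
      using sandwiched_mono[OF bB(3), of n] by (auto simp: sandwiched_def eigfun_0 add.commute)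
    \<comment> \<open>\<open>b \<ge> 1\<close> keeps the denominator at least
      \<open>eigval a ^ (n + m)\<close>, which later absorbs this power in the error.\<close>
    have "?c ^ (n + m) \<le> b * ?c ^ (n + m)" using bB(1) cp[of "n + m"] by simp
    then have g1: "?c ^ (n + m) \<le> ?g (n + m) 0" using z by linarith
    then have g0: "0 < ?g (n + m) 0" using cp[of "n + m"] by linarith
    have b_le_B: "b \<le> B" using z cp[of "n + m"] by (smt (verit) mult_le_cancel_right)
    let ?D = "?g m x / ?g (n + m) 0 - ?h x / ?c ^ n"
    have D: "?D = (?g m x * ?c ^ n - ?h x * ?g (n + m) 0) / (?g (n + m) 0 * ?c ^ n)"
      using g0 eigval_pos by (intro diff_frac_eq) auto
    have "\<bar>?g m x * ?c ^ n - ?h x * ?g (n + m) 0\<bar> \<le> (B - b) * (?c ^ (n + m) * ?h x)"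
    proof -
      have "?g m x * ?c ^ n \<le> B * (?c ^ m * ?h x) * ?c ^ n" "b * (?c ^ m * ?h x) * ?c ^ n \<le> ?g m x * ?c ^ n"
        using x cp[of n] by (auto intro!: mult_right_mono)
      moreover have "?h x * ?g (n + m) 0 \<le> ?h x * (B * ?c ^ (n + m))"
        "?h x * (b * ?c ^ (n + m)) \<le> ?h x * ?g (n + m) 0"
        using z eigfun_nonneg[of x] by (auto intro!: mult_left_mono)
      ultimately show ?thesis by (simp add: abs_le_iff algebra_simps power_add)
    qed
    also have "\<dots> \<le> (B - b) * (?c ^ (n + m) * 1)"
      using b_le_B cp[of "n + m"] eigfun_le_1 by (intro mult_left_mono) auto
    also have "\<dots> \<le> (B - b) * ?g (n + m) 0"
      using b_le_B g1 by (simp add: mult_left_mono)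
    also have "\<dots> < \<epsilon> * ?c ^ n * ?g (n + m) 0"
      using bB(2) g0 by (intro mult_strict_right_mono)
    finally have "\<bar>?g m x * ?c ^ n - ?h x * ?g (n + m) 0\<bar> < \<epsilon> * (?g (n + m) 0 * ?c ^ n)"
      by (simp add: mult_ac)
    then show "norm ?D < \<epsilon>"
      unfolding D using g0 cp[of n] by (simp add: abs_mult divide_less_eq)
  qed
qed

lemma survival_0_tendsto: "(\<lambda>n. survival a n 0) \<longlonglongrightarrow> 0"
proof -
  obtain B where B: "1 \<le> B" "\<And>m x. eigval a ^ m * eigfun a x \<le> survival a m x"
    "\<And>m x. survival a m x \<le> B * (eigval a ^ m * eigfun a x)"
    by (rule survival_bounds) blast
  have bounds: "0 \<le> survival a n 0" "survival a n 0 \<le> B * eigval a ^ n" for n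
    using B(2)[of n 0] B(3)[of n 0] zero_less_power[OF eigval_pos, of n] by (simp_all add: eigfun_0)
  have "(\<lambda>n. B * eigval a ^ n) \<longlonglongrightarrow> B * 0"
    using eigval_pos eigval_less_1 by (intro tendsto_intros LIMSEQ_realpow_zero) auto
  then show ?thesis
    using tendsto_sandwich[of "\<lambda>_. 0" "\<lambda>n. survival a n 0" sequentially "\<lambda>n. B * eigval a ^ n" 0] bounds
    by simp
qed

end

section \<open>The walk killed on leaving the interval\<close>

lemma walk_coin: "walk (uniform_count_measure {-1, 1 :: int}) (\<lambda>_ e. e)"
proof (intro walk.intro walk_axioms.intro)
  show "prob_space (uniform_count_measure {-1, 1 :: int})"
    by (rule prob_space_uniform_count_measure) auto
  show "(\<lambda>e. e) \<in> uniform_count_measure {-1, 1 :: int} \<rightarrow>\<^sub>M count_space UNIV"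
    by (auto simp: measurable_def space_uniform_count_measure sets_uniform_count_measure)
qed (simp add: space_uniform_count_measure)

text \<open>With a step map that ignores the site, the recursion for \<open>position\<close> is the
  partial sum.\<close>

lemma srw_eq_law: "srw = walk.law (uniform_count_measure {-1, 1 :: int}) (\<lambda>_ e. e)"
proof -
  interpret coin: walk "uniform_count_measure {-1, 1 :: int}" "\<lambda>_ e. e" by (rule walk_coin)
  have "coin.position \<xi> n = (\<Sum>k<n. \<xi> k)" for \<xi> n
    by (induction n) auto
  then have "coin.position = (\<lambda>\<xi> n. \<Sum>k<n. \<xi> k)" by (simp add: fun_eq_iff)
  then show ?thesis by (simp add: srw_def coin.law_def)
qed

lemma measure_srw_step:
  assumes "\<Lambda> \<in> sets (F n)" "d = 1 \<or> d = - 1"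
  shows "measure srw {\<omega> \<in> \<Lambda>. X n \<omega> = k \<and> X (Suc n) \<omega> = k + d}
    = measure srw {\<omega> \<in> \<Lambda>. X n \<omega> = k} / 2"
proof -
  have "{e \<in> space (uniform_count_measure {-1, 1 :: int}). e = d} = {d}"
    using assms(2) by (auto simp: space_uniform_count_measure)
  moreover have "measure (uniform_count_measure {-1, 1 :: int}) {d} = 1 / 2"
    using assms(2) by (subst measure_uniform_count_measure) auto
  ultimately have "\<P>(e in uniform_count_measure {-1, 1 :: int}. e = d) = 1 / 2"
    by (simp only:)
  with walk.measure_law_step[OF walk_coin assms(1), of k d] show ?thesis
    unfolding srw_eq_law by simp
qed

lemma AE_srw_start: "AE \<omega> in srw. X 0 \<omega> = 0"
  unfolding srw_eq_law by (rule walk.AE_law_start[OF walk_coin])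

interpretation srw: prob_space srw
  by (rule prob_space_srw)

definition alive :: "int \<Rightarrow> nat \<Rightarrow> (nat \<Rightarrow> int) set" where
  "alive a n = {\<omega> \<in> paths. S_star n \<omega> < a}"

lemma alive_eq: "alive a n = {\<omega> \<in> paths. \<forall>k\<le>n. \<bar>X k \<omega>\<bar> < a}"
proof -
  have "S_star n \<omega> < a \<longleftrightarrow> (\<forall>k\<le>n. \<bar>X k \<omega>\<bar> < a)" for \<omega>
    unfolding S_star_def by (subst Max_less_iff) auto
  then show ?thesis by (simp add: alive_def)
qed

lemma alive_Suc: "alive a (Suc n) = alive a n \<inter> {\<omega> \<in> paths. \<bar>X (Suc n) \<omega>\<bar> < a}"
  unfolding alive_eq le_Suc_eq by blast

lemma sets_alive: "alive a n \<in> sets (F n)"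
proof -
  have "{\<omega> \<in> paths. \<bar>X k \<omega>\<bar> < a} \<in> sets (F n)" if "k \<le> n" for k
    using measurable_sets[OF measurable_X_F[OF that], of "{x. \<bar>x\<bar> < a}"]
    by (simp add: vimage_def Int_def conj_commute)
  then have "(\<Inter>k\<in>{..n}. {\<omega> \<in> paths. \<bar>X k \<omega>\<bar> < a}) \<in> sets (F n)"
    by (intro sets.finite_INT) auto
  also have "(\<Inter>k\<in>{..n}. {\<omega> \<in> paths. \<bar>X k \<omega>\<bar> < a}) = alive a n"
    by (auto simp: alive_eq)
  finally show ?thesis .
qed

text \<open>Given \<open>X n = k\<close>, the two neighbours are equally likely independently of
  \<open>\<Lambda>\<close>, and averaging \<open>f m\<close> over them gives
  \<open>f (Suc m) k\<close>. Finite sums over \<open>k\<close> replace conditional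
  expectations.\<close>

lemma killed_heat_integral_step:
  assumes f: "killed_heat a f" and \<Lambda>: "\<Lambda> \<in> sets (F n)"
  shows "(\<integral>\<omega>. indicator (\<Lambda> \<inter> alive a n) \<omega> * f (Suc m) (X n \<omega>) \<partial>srw)
    = (\<integral>\<omega>. indicator (\<Lambda> \<inter> alive a (Suc n)) \<omega> * f m (X (Suc n) \<omega>) \<partial>srw)"
proof -
  let ?A = "\<Lambda> \<inter> alive a n" and ?I = "{-a<..<a}"
  have A: "?A \<in> sets (F n)" using \<Lambda> sets_alive by auto
  let ?now = "\<lambda>k. {\<omega> \<in> ?A. X n \<omega> = k}"
  let ?to = "\<lambda>k d. {\<omega> \<in> ?A. X n \<omega> = k \<and> X (Suc n) \<omega> = k + d}"
  have "?now k = ?A \<inter> {\<omega> \<in> paths. X n \<omega> = k}" for k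
    using sets_F_subset_paths[OF A] by auto
  then have now: "?now k \<in> sets srw" for k
    using sets_F_srw[OF sets.Int[OF A X_eq_in_sets_F[of n n k]]] by simp
  have "?to k d = ?now k \<inter> {\<omega> \<in> paths. X (Suc n) \<omega> = k + d}" for k d
    using sets_F_subset_paths[OF A] by auto
  then have to: "?to k d \<in> sets srw" for k d
    using sets.Int[OF now[of k] sets_F_srw[OF X_eq_in_sets_F[of "Suc n" "Suc n" "k + d"]]] by simp
  have fin: "integrable srw (\<lambda>\<omega>. indicator B \<omega> * r :: real)" if "B \<in> sets srw" for B r
    using that by (intro integrable_mult_left) (simp add: srw.emeasure_finite less_top[symmetric])
  have int: "(\<integral>\<omega>. indicator B \<omega> * r \<partial>srw) = measure srw B * r" if "B \<in> sets srw" for B and r :: real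
    using sets.sets_into_space[OF that] by (simp add: Int_absorb2)
  have "(\<integral>\<omega>. indicator ?A \<omega> * f (Suc m) (X n \<omega>) \<partial>srw)
      = (\<integral>\<omega>. (\<Sum>k\<in>?I. indicator (?now k) \<omega> * f (Suc m) k) \<partial>srw)"
  proof (rule Bochner_Integration.integral_cong)
    fix \<omega>
    have "(\<Sum>k\<in>?I. indicator (?now k) \<omega> * f (Suc m) k)
      = (\<Sum>k\<in>?I. if X n \<omega> = k then indicator ?A \<omega> * f (Suc m) k else 0)"
      by (intro sum.cong) (auto simp: indicator_def)
    also have "\<dots> = indicator ?A \<omega> * f (Suc m) (X n \<omega>)"
      by (auto simp: sum.delta indicator_def alive_eq abs_less_iff)
    finally show "indicator ?A \<omega> * f (Suc m) (X n \<omega>)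
      = (\<Sum>k\<in>?I. indicator (?now k) \<omega> * f (Suc m) k)" ..
  qed simp
  also have "\<dots> = (\<Sum>k\<in>?I. measure srw (?now k) * f (Suc m) k)"
    by (simp only: Bochner_Integration.integral_sum fin int now)
  also have "\<dots> = (\<Sum>k\<in>?I. measure srw (?to k 1) * f m (k + 1) + measure srw (?to k (- 1)) * f m (k - 1))"
  proof (rule sum.cong)
    fix k assume "k \<in> ?I"
    then have fk: "f (Suc m) k = (f m (k + 1) + f m (k - 1)) / 2"
      using f by (auto simp: killed_heat_def)
    have "measure srw (?to k 1) = measure srw (?now k) / 2"
      "measure srw (?to k (- 1)) = measure srw (?now k) / 2"
      by (simp_all only: measure_srw_step[OF A] simp_thms)
    then show "measure srw (?now k) * f (Suc m) k
      = measure srw (?to k 1) * f m (k + 1) + measure srw (?to k (- 1)) * f m (k - 1)"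
      by (simp only: fk) (simp add: algebra_simps)
  qed simp
  also have "\<dots> = (\<integral>\<omega>. (\<Sum>k\<in>?I. indicator (?to k 1) \<omega> * f m (k + 1)
      + indicator (?to k (- 1)) \<omega> * f m (k - 1)) \<partial>srw)"
    by (simp only: Bochner_Integration.integral_sum Bochner_Integration.integral_add
        Bochner_Integration.integrable_add fin int to)
  also have "\<dots> = (\<integral>\<omega>. indicator (\<Lambda> \<inter> alive a (Suc n)) \<omega> * f m (X (Suc n) \<omega>) \<partial>srw)"
  proof (rule Bochner_Integration.integral_cong)
    fix \<omega> assume "\<omega> \<in> space srw"
    then have \<omega>: "\<omega> \<in> paths" by simp
    have "(\<Sum>k\<in>?I. indicator (?to k 1) \<omega> * f m (k + 1) + indicator (?to k (- 1)) \<omega> * f m (k - 1))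
      = (\<Sum>k\<in>?I. if X n \<omega> = k then indicator ?A \<omega> * f m (X (Suc n) \<omega>) else 0)"
      using X_Suc_cases[OF \<omega>, of n] by (intro sum.cong) (auto simp: indicator_def)
    also have "\<dots> = indicator ?A \<omega> * f m (X (Suc n) \<omega>)"
      by (auto simp: sum.delta indicator_def alive_eq abs_less_iff)
    \<comment> \<open>A path that leaves at time \<open>Suc n\<close> contributes nothing, since
      \<open>f\<close> vanishes outside.\<close>
    also have "\<dots> = indicator (\<Lambda> \<inter> alive a (Suc n)) \<omega> * f m (X (Suc n) \<omega>)"
      using f \<omega> by (auto simp: indicator_def alive_Suc killed_heat_def)
    finally show "(\<Sum>k\<in>?I. indicator (?to k 1) \<omega> * f m (k + 1) + indicator (?to k (- 1)) \<omega> * f m (k - 1))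
      = indicator (\<Lambda> \<inter> alive a (Suc n)) \<omega> * f m (X (Suc n) \<omega>)" .
  qed simp
  finally show ?thesis .
qed

lemma killed_heat_integral:
  assumes f: "killed_heat a f" and \<Lambda>: "\<Lambda> \<in> sets (F n)"
  shows "(\<integral>\<omega>. indicator (\<Lambda> \<inter> alive a n) \<omega> * f (m + j) (X n \<omega>) \<partial>srw)
    = (\<integral>\<omega>. indicator (\<Lambda> \<inter> alive a (n + j)) \<omega> * f m (X (n + j) \<omega>) \<partial>srw)"
proof (induction j arbitrary: m)
  case (Suc j)
  have "\<Lambda> \<in> sets (F (n + j))" using \<Lambda> by (rule sets_F_mono[rotated]) simp
  then show ?case
    using Suc.IH[of "Suc m"] killed_heat_integral_step[OF f, of \<Lambda> "n + j" m] by simp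
qed simp

text \<open>The integral identity is run until no steps remain: \<open>survival a 0\<close> is the
  indicator of the interval, hence 1 on surviving paths.\<close>

lemma measure_alive_at:
  assumes \<Lambda>: "\<Lambda> \<in> sets (F n)"
  shows "measure srw (\<Lambda> \<inter> alive a (n + m))
    = (\<integral>\<omega>. indicator (\<Lambda> \<inter> alive a n) \<omega> * survival a m (X n \<omega>) \<partial>srw)"
proof -
  have "(\<integral>\<omega>. indicator (\<Lambda> \<inter> alive a n) \<omega> * survival a (0 + m) (X n \<omega>) \<partial>srw)
    = (\<integral>\<omega>. indicator (\<Lambda> \<inter> alive a (n + m)) \<omega> * survival a 0 (X (n + m) \<omega>) \<partial>srw)"
    by (rule killed_heat_integral[OF killed_heat_survival \<Lambda>])
  also have "\<dots> = (\<integral>\<omega>. indicator (\<Lambda> \<inter> alive a (n + m)) \<omega> \<partial>srw)"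
    by (intro Bochner_Integration.integral_cong) (auto simp: alive_eq indicator_def)
  also have "\<dots> = measure srw (\<Lambda> \<inter> alive a (n + m))"
    using sets_F_subset_paths[OF \<Lambda>] by (simp add: Int_absorb2 le_infI1)
  finally show ?thesis by simp
qed

lemma measure_alive:
  assumes "0 < a"
  shows "measure srw (alive a p) = survival a p 0"
proof -
  have "measure srw (alive a p) = measure srw (paths \<inter> alive a (0 + p))"
    by (rule arg_cong[where f="measure srw"]) (auto simp: alive_eq)
  also have "\<dots> = (\<integral>\<omega>. indicator (paths \<inter> alive a 0) \<omega> * survival a p (X 0 \<omega>) \<partial>srw)"
    by (rule measure_alive_at[OF paths_in_sets_F])
  also have "\<dots> = (\<integral>\<omega>. survival a p 0 \<partial>srw)"
  proof (rule integral_cong_AE)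
    show "(\<lambda>\<omega>. indicator (paths \<inter> alive a 0) \<omega> * survival a p (X 0 \<omega>)) \<in> borel_measurable srw"
      using sets_F_srw[OF sets_alive[of a 0]] sets_F_srw[OF paths_in_sets_F[of 0]] by measurable
    show "AE \<omega> in srw. indicator (paths \<inter> alive a 0) \<omega> * survival a p (X 0 \<omega>) = survival a p 0"
      using AE_srw_start AE_space by eventually_elim (use assms in \<open>auto simp: alive_eq\<close>)
  qed simp
  finally show ?thesis using srw.prob_space by simp
qed

lemma M_eq: "M a n \<omega> = indicator (alive a n) \<omega> * (eigfun a (X n \<omega>) / eigval a ^ n)"
  by (auto simp: M_def alive_def[symmetric] eigval_def indicator_def power_int_minus_divide eigfun_def alive_eq)

lemma measurable_M: "M a n \<in> borel_measurable (F n)"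
proof -
  have "(\<lambda>\<omega>. eigfun a (X n \<omega>) / eigval a ^ n) \<in> borel_measurable (F n)"
    by (rule measurable_compose[OF measurable_X_F[OF order_refl]]) simp
  then show ?thesis
    unfolding M_eq[abs_def] using sets_alive[of a n] by (intro borel_measurable_times) auto
qed

text \<open>Supplies the parity hypothesis of \<open>survival_ratio_tendsto\<close> at the site
  \<open>X n\<close>.\<close>

lemma AE_parity: "AE \<omega> in srw. \<forall>n. even (X n \<omega> + int n)"
  using AE_srw_start AE_space
proof eventually_elim
  case (elim \<omega>)
  show ?case
  proof
    fix n show "even (X n \<omega> + int n)"
    proof (induction n)
      case (Suc n)
      then show ?case using X_Suc_cases[of \<omega> n] elim by auto
    qed (use elim in simp)
  qed
qed

section \<open>The transformed walk\<close>

text \<open>The Doob h-transform of the step weight 1 / 2 by \<open>eigfun\<close>, normalised by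
  \<open>eigval a\<close>. Outside, where \<open>eigfun\<close> is 0, the value 1 / 2 keeps it a
  probability.\<close>

definition up_prob :: "int \<Rightarrow> int \<Rightarrow> real" where
  "up_prob a k = (if \<bar>k\<bar> < a then eigfun a (k + 1) / (2 * eigval a * eigfun a k) else 1 / 2)"

abbreviation unit_uniform :: "real measure" where
  "unit_uniform \<equiv> uniform_measure lborel {0..1}"

definition biased_step :: "int \<Rightarrow> int \<Rightarrow> real \<Rightarrow> int" where
  "biased_step a k u = (if u < up_prob a k then 1 else - 1)"

lemma walk_biased: "walk unit_uniform (biased_step a)"
proof -
  interpret prob_space unit_uniform by (rule prob_space_uniform_measure) auto
  show ?thesis
  proof
    show "biased_step a x \<in> unit_uniform \<rightarrow>\<^sub>M count_space UNIV" for x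
      unfolding biased_step_def[abs_def] by measurable
  qed (auto simp: biased_step_def)
qed

definition transformed_law :: "int \<Rightarrow> (nat \<Rightarrow> int) measure" where
  "transformed_law a = walk.law unit_uniform (biased_step a)"

section \<open>The martingale property\<close>

context
  fixes a :: int
  assumes a: "a \<ge> 2"
begin

lemmas eig = eigval_pos[OF a] eigval_less_1[OF a] eigfun_nonneg[OF a] eigfun_le_1[OF a] eigfun_pos[OF a]

lemma M_nonneg: "0 \<le> M a n \<omega>"
  using eig by (simp add: M_eq)

lemma M_le: "M a n \<omega> \<le> 1 / eigval a ^ n"
  using eig eig(4)[of "X n \<omega>"] by (auto simp: M_eq indicator_def divide_right_mono)

lemma measurable_M_srw [measurable]: "M a n \<in> borel_measurable srw"
  using measurable_from_subalg[OF subalgebra_F measurable_M] .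

lemma integrable_M: "integrable srw (M a n)"
  using M_le[of n] M_nonneg[of n] by (intro srw.integrable_const_bound[where B="1 / eigval a ^ n"]) auto

lemma integrable_indicator_M:
  "\<Lambda> \<in> sets (F m) \<Longrightarrow> integrable srw (\<lambda>\<omega>. indicator \<Lambda> \<omega> * M a n \<omega>)"
  using integrable_mult_indicator[OF _ integrable_M[of n], of \<Lambda>] sets_F_srw by simp

lemma integral_M_mono_time:
  assumes \<Lambda>: "\<Lambda> \<in> sets (F m)" and "m \<le> n"
  shows "(\<integral>\<omega>. indicator \<Lambda> \<omega> * M a n \<omega> \<partial>srw) = (\<integral>\<omega>. indicator \<Lambda> \<omega> * M a m \<omega> \<partial>srw)"
proof -
  obtain j where n: "n = m + j" using \<open>m \<le> n\<close> le_Suc_ex by blast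
  \<comment> \<open>Over the common denominator \<open>eigval a ^ (m + j)\<close>, the two integrals
    are those of \<open>killed_heat_integral\<close> for the eigenfunction solution:
    \<open>l = 0\<close> at the later time, \<open>l = j\<close> at the earlier.\<close>
  have eq: "indicator \<Lambda> \<omega> * M a i \<omega>
      = indicator (\<Lambda> \<inter> alive a i) \<omega> * (eigval a ^ l * eigfun a (X i \<omega>)) / eigval a ^ (i + l)" for i l \<omega>
    using eig by (auto simp: M_eq indicator_def power_add)
  have "(\<integral>\<omega>. indicator (\<Lambda> \<inter> alive a m) \<omega> * (eigval a ^ (0 + j) * eigfun a (X m \<omega>)) \<partial>srw)
    = (\<integral>\<omega>. indicator (\<Lambda> \<inter> alive a (m + j)) \<omega> * (eigval a ^ 0 * eigfun a (X (m + j) \<omega>)) \<partial>srw)"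
    by (rule killed_heat_integral[OF killed_heat_eigfun[OF a] \<Lambda>])
  then show ?thesis
    unfolding n eq[where i="m + j" and l=0] eq[where i=m and l=j] by simp
qed

lemma integral_M: "(\<integral>\<omega>. M a n \<omega> \<partial>srw) = 1"
proof -
  have "(\<integral>\<omega>. M a n \<omega> \<partial>srw) = (\<integral>\<omega>. indicator paths \<omega> * M a n \<omega> \<partial>srw)"
    by (intro Bochner_Integration.integral_cong) auto
  also have "\<dots> = (\<integral>\<omega>. indicator paths \<omega> * M a 0 \<omega> \<partial>srw)"
    by (rule integral_M_mono_time[OF paths_in_sets_F]) simp
  also have "\<dots> = (\<integral>\<omega>. 1 \<partial>srw)"
  proof (rule integral_cong_AE)
    show "(\<lambda>\<omega>. indicator paths \<omega> * M a 0 \<omega>) \<in> borel_measurable srw"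
      using sets_F_srw[OF paths_in_sets_F[of 0]] by measurable
    show "AE \<omega> in srw. indicator paths \<omega> * M a 0 \<omega> = 1"
      using AE_srw_start AE_space
      by eventually_elim (use a in \<open>auto simp: M_eq alive_eq eigfun_0\<close>)
  qed simp
  finally show ?thesis using srw.prob_space by simp
qed

lemma martingale_M: "martingale srw F (M a)"
  unfolding martingale_def
proof (intro conjI allI impI)
  fix m n :: nat assume "m \<le> n"
  interpret finite_measure_subalgebra srw "F m"
    by unfold_locales (rule subalgebra_F)
  show "AE \<omega> in srw. real_cond_exp srw (F m) (M a n) \<omega> = M a m \<omega>"
    using integral_M_mono_time[OF _ \<open>m \<le> n\<close>]
    by (intro real_cond_exp_charact integrable_M measurable_M)
      (simp add: set_lebesgue_integral_def)
qed (use filtration_F in \<open>auto intro: subalgebra_F measurable_M integrable_M\<close>)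

section \<open>The limit under conditioning on survival\<close>

lemma conditioned_measure_tendsto:
  assumes \<Lambda>: "\<Lambda> \<in> sets (F n)"
  shows "(\<lambda>p. measure srw (\<Lambda> \<inter> alive a p) / measure srw (alive a p))
    \<longlonglongrightarrow> (\<integral>\<omega>. indicator (\<Lambda> \<inter> alive a n) \<omega> * M a n \<omega> \<partial>srw)"
\<comment> \<open>With \<open>p = m + n\<close>, there are \<open>m\<close> steps left after time
  \<open>n\<close>, and the Markov property turns the quotient into an integral of
  \<open>?h m (X n \<omega>)\<close>.\<close>
proof (rule LIMSEQ_offset[where k=n])
  let ?h = "\<lambda>m x. survival a m x / survival a (n + m) 0"
  have "(\<lambda>m. \<integral>\<omega>. indicator (\<Lambda> \<inter> alive a n) \<omega> * ?h m (X n \<omega>) \<partial>srw)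
    \<longlonglongrightarrow> (\<integral>\<omega>. indicator (\<Lambda> \<inter> alive a n) \<omega> * M a n \<omega> \<partial>srw)"
  proof -
    have al: "\<Lambda> \<inter> alive a n \<in> sets srw" using \<Lambda> sets_alive by (intro sets_F_srw[of _ n]) auto
    obtain B where B: "1 \<le> B" "\<And>m x. eigval a ^ m * eigfun a x \<le> survival a m x"
      "\<And>m x. survival a m x \<le> B * (eigval a ^ m * eigfun a x)"
      by (rule survival_bounds[OF a]) blast
    have cp: "0 < eigval a ^ i" for i using eig(1) by simp
    \<comment> \<open>The dominating constant: the numerator is at most
      \<open>B * eigval a ^ m\<close>, the denominator at least
      \<open>eigval a ^ (n + m)\<close>.\<close>
    have bound: "\<bar>?h m x\<bar> \<le> B / eigval a ^ n" for m x
    proof -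
      have g: "eigval a ^ (n + m) \<le> survival a (n + m) 0"
        using B(2)[of "n + m" 0] by (simp add: eigfun_0[OF a])
      have "0 \<le> survival a m x"
        using B(2)[of m x] cp[of m] eig(3)[of x] by (meson less_imp_le mult_nonneg_nonneg order_trans)
      moreover have "survival a m x \<le> B * (eigval a ^ m * 1)"
        using B(1) B(3)[of m x] cp[of m] eig(4)[of x]
        by (meson less_imp_le mult_left_mono order_trans zero_le_one)
      ultimately have "\<bar>?h m x\<bar> \<le> B * (eigval a ^ m * 1) / eigval a ^ (n + m)"
        using g cp[of "n + m"] by (auto intro!: frac_le)
      then show ?thesis using cp[of m] eig(1) by (simp add: power_add)
    qed
    show ?thesis
    proof (rule integral_dominated_convergence[where w="\<lambda>_. B / eigval a ^ n"])
      show "(\<lambda>\<omega>. indicator (\<Lambda> \<inter> alive a n) \<omega> * M a n \<omega>) \<in> borel_measurable srw"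
        using al by measurable
      show "(\<lambda>\<omega>. indicator (\<Lambda> \<inter> alive a n) \<omega> * ?h m (X n \<omega>)) \<in> borel_measurable srw" for m
        using al by measurable
      show "AE \<omega> in srw. (\<lambda>m. indicator (\<Lambda> \<inter> alive a n) \<omega> * ?h m (X n \<omega>))
        \<longlonglongrightarrow> indicator (\<Lambda> \<inter> alive a n) \<omega> * M a n \<omega>"
        using AE_parity
      proof eventually_elim
        case (elim \<omega>)
        then have "(\<lambda>m. ?h m (X n \<omega>)) \<longlonglongrightarrow> eigfun a (X n \<omega>) / eigval a ^ n"
          by (intro survival_ratio_tendsto[OF a]) simp
        then show ?case by (auto simp: M_eq indicator_def)
      qed
      show "integrable srw (\<lambda>_. B / eigval a ^ n)" by simp
      show "AE \<omega> in srw. norm (indicator (\<Lambda> \<inter> alive a n) \<omega> * ?h m (X n \<omega>)) \<le> B / eigval a ^ n" for m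
        using bound[of m] B(1) cp[of n] by (auto simp: indicator_def)
    qed
  qed
  then show "(\<lambda>m. measure srw (\<Lambda> \<inter> alive a (m + n)) / measure srw (alive a (m + n)))
    \<longlonglongrightarrow> (\<integral>\<omega>. indicator (\<Lambda> \<inter> alive a n) \<omega> * M a n \<omega> \<partial>srw)"
    using measure_alive_at[OF \<Lambda>] a by (simp add: measure_alive add.commute)
qed

section \<open>Failure of uniform integrability\<close>

lemma not_uniformly_integrable_M: "\<not> uniformly_integrable srw (M a)"
proof
  assume "uniformly_integrable srw (M a)"
  let ?T = "\<lambda>n K. \<integral>\<^sup>+\<omega>. ennreal \<bar>M a n \<omega>\<bar> * indicator {\<omega>. K \<le> \<bar>M a n \<omega>\<bar>} \<omega> \<partial>srw"
  have "1 \<le> (SUP n. ?T n K)" for K :: real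
  proof -
    \<comment> \<open>Where \<open>M a n\<close> is below \<open>K\<close> it is at most
      \<open>\<bar>K\<bar>\<close>, and it vanishes off \<open>alive a n\<close>; removing this part
      from the total mass 1 loses at most \<open>\<bar>K\<bar> * survival a n 0\<close>.\<close>
    have ge: "ennreal (1 - \<bar>K\<bar> * survival a n 0) \<le> (SUP n. ?T n K)" for n
    proof -
      have B: "{\<omega> \<in> space srw. K \<le> \<bar>M a n \<omega>\<bar>} \<in> sets srw" by measurable
      have al: "alive a n \<in> sets srw" by (rule sets_F_srw[OF sets_alive])
      have int: "integrable srw (\<lambda>\<omega>. indicator {\<omega> \<in> space srw. K \<le> \<bar>M a n \<omega>\<bar>} \<omega> * M a n \<omega>)"
        using integrable_mult_indicator[OF B integrable_M[of n]] by simp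
      have int': "integrable srw (\<lambda>\<omega>. M a n \<omega> - \<bar>K\<bar> * indicator (alive a n) \<omega>)"
        using al by (intro Bochner_Integration.integrable_diff integrable_M integrable_mult_right)
          (simp add: srw.emeasure_finite less_top[symmetric])
      have "1 - \<bar>K\<bar> * survival a n 0 = (\<integral>\<omega>. M a n \<omega> - \<bar>K\<bar> * indicator (alive a n) \<omega> \<partial>srw)"
        using al a integrable_M[of n]
        by (subst Bochner_Integration.integral_diff)
          (auto simp: integral_M measure_alive[symmetric] srw.emeasure_finite less_top[symmetric]
            sets.Int_space_eq2[of _ srw, simplified])
      also have "\<dots> \<le> (\<integral>\<omega>. indicator {\<omega> \<in> space srw. K \<le> \<bar>M a n \<omega>\<bar>} \<omega> * M a n \<omega> \<partial>srw)"
      proof (rule integral_mono[OF int' int])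
        fix \<omega>
        have "M a n \<omega> = 0" if "\<omega> \<notin> alive a n" using that by (simp add: M_eq)
        then show "M a n \<omega> - \<bar>K\<bar> * indicator (alive a n) \<omega>
            \<le> indicator {\<omega> \<in> space srw. K \<le> \<bar>M a n \<omega>\<bar>} \<omega> * M a n \<omega>" if "\<omega> \<in> space srw"
          using M_nonneg[of n \<omega>] that by (auto simp: indicator_def)
      qed
      finally have "ennreal (1 - \<bar>K\<bar> * survival a n 0)
        \<le> ennreal (\<integral>\<omega>. indicator {\<omega> \<in> space srw. K \<le> \<bar>M a n \<omega>\<bar>} \<omega> * M a n \<omega> \<partial>srw)"
        by (rule ennreal_leI)
      also have "\<dots> = (\<integral>\<^sup>+\<omega>. ennreal (indicator {\<omega> \<in> space srw. K \<le> \<bar>M a n \<omega>\<bar>} \<omega> * M a n \<omega>) \<partial>srw)"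
        using int M_nonneg by (intro nn_integral_eq_integral[symmetric]) auto
      also have "\<dots> = ?T n K"
        using M_nonneg by (intro nn_integral_cong) (auto simp: indicator_def)
      also have "\<dots> \<le> (SUP n. ?T n K)" by (rule SUP_upper) simp
      finally show ?thesis .
    qed
    have "(\<lambda>n. 1 - \<bar>K\<bar> * survival a n 0) \<longlonglongrightarrow> 1 - \<bar>K\<bar> * 0"
      by (intro tendsto_intros survival_0_tendsto[OF a])
    then have "(\<lambda>n. ennreal (1 - \<bar>K\<bar> * survival a n 0)) \<longlonglongrightarrow> ennreal (1 - \<bar>K\<bar> * 0)"
      by (rule tendsto_ennrealI)
    then show ?thesis
      using ge by (intro LIMSEQ_le_const2[where X="\<lambda>n. ennreal (1 - \<bar>K\<bar> * survival a n 0)"]) auto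
  qed
  moreover have "((\<lambda>K. SUP n. ?T n K) \<longlongrightarrow> 0) at_top"
    using \<open>uniformly_integrable srw (M a)\<close> by (simp add: uniformly_integrable_def)
  ultimately have "(1 :: ennreal) \<le> 0"
    by (intro tendsto_lowerbound[where F="at_top :: real filter"]) auto
  then show False by simp
qed

section \<open>Existence, uniqueness and transitions of \<open>Q\<close>\<close>

lemma up_prob_nonneg: "0 \<le> up_prob a k" and up_prob_le_1: "up_prob a k \<le> 1"
  and down_prob: "\<bar>k\<bar> < a \<Longrightarrow> 1 - up_prob a k = eigfun a (k - 1) / (2 * eigval a * eigfun a k)"
proof -
  show "0 \<le> up_prob a k" using eig by (auto simp: up_prob_def)
  \<comment> \<open>By \<open>eigfun_step\<close>, the transformed weights of the two neighbours add
    up to 1.\<close>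
  show d: "1 - up_prob a k = eigfun a (k - 1) / (2 * eigval a * eigfun a k)" if "\<bar>k\<bar> < a"
    using that eig(5)[OF that] eig(1) eigfun_step[OF a that]
    by (simp add: up_prob_def field_simps)
  show "up_prob a k \<le> 1"
  proof (cases "\<bar>k\<bar> < a")
    case True
    have "0 \<le> 1 - up_prob a k" unfolding d[OF True] using eig by auto
    then show ?thesis by simp
  qed (simp add: up_prob_def)
qed

lemma prob_biased_step:
  "\<P>(u in unit_uniform. biased_step a k u = 1) = up_prob a k"
  "\<P>(u in unit_uniform. biased_step a k u = - 1) = 1 - up_prob a k"
proof -
  interpret walk unit_uniform "biased_step a" by (rule walk_biased)
  have "measure unit_uniform {..<up_prob a k} = measure lborel ({0..1} \<inter> {..<up_prob a k})"
    by (subst measure_uniform_measure) auto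
  also have "{0..1} \<inter> {..<up_prob a k} = {0..<up_prob a k}" using up_prob_le_1[of k] by auto
  finally have *: "measure unit_uniform {..<up_prob a k} = up_prob a k"
    using up_prob_nonneg by simp
  have "{u \<in> space unit_uniform. biased_step a k u = 1} = {..<up_prob a k}"
    by (auto simp: biased_step_def)
  then show up: "\<P>(u in unit_uniform. biased_step a k u = 1) = up_prob a k" using * by simp
  have "{u \<in> space unit_uniform. biased_step a k u = - 1} = space unit_uniform - {..<up_prob a k}"
    by (auto simp: biased_step_def)
  then show "\<P>(u in unit_uniform. biased_step a k u = - 1) = 1 - up_prob a k"
    using * prob_compl[of "{..<up_prob a k}"] by simp
qed

text \<open>Each step multiplies the density by the ratio of the transformed step probability to 1 /
  2. The step out of the interval has transformed probability 0, as \<open>eigfun\<close> vanishes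
  there; afterwards both sides are 0.\<close>

lemma M_step:
  assumes w: "w \<in> paths"
  shows "M a n w * \<P>(u in unit_uniform. biased_step a (X n w) u = X (Suc n) w - X n w)
    = M a (Suc n) w / 2"
proof (cases "w \<in> alive a n")
  case True
  then have k: "\<bar>X n w\<bar> < a" by (simp add: alive_eq)
  have "M a (Suc n) w = eigfun a (X (Suc n) w) / eigval a ^ Suc n"
    using True w by (auto simp: M_eq alive_Suc eigfun_def indicator_def)
  moreover have "\<P>(u in unit_uniform. biased_step a (X n w) u = X (Suc n) w - X n w)
      = eigfun a (X (Suc n) w) / (2 * eigval a * eigfun a (X n w))"
    using X_Suc_cases[OF w, of n]
  proof
    assume up: "X (Suc n) w = X n w + 1"
    then have "X (Suc n) w - X n w = 1" by simp
    then show ?thesis using k up by (simp only: prob_biased_step) (simp add: up_prob_def)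
  next
    assume down: "X (Suc n) w = X n w + (- 1)"
    then have "X (Suc n) w - X n w = - 1" by simp
    then show ?thesis using down by (simp only: prob_biased_step down_prob[OF k]) simp
  qed
  moreover have "M a n w = eigfun a (X n w) / eigval a ^ n" using True by (simp add: M_eq)
  ultimately show ?thesis using eig(1) eig(5)[OF k] by simp
next
  case False
  then show ?thesis by (simp add: M_eq alive_Suc)
qed

text \<open>The ratios of \<open>M_step\<close> multiply up along \<open>w\<close>; at time 0 both
  laws sit at 0, where \<open>M a 0\<close> is 1.\<close>

lemma measure_transformed_atom:
  assumes w: "w \<in> paths"
  shows "measure (transformed_law a) (atom n w) = M a n w * measure srw (atom n w)"
proof (induction n)
  case 0
  have "M a 0 w = 1" if "X 0 w = 0"
    using that w a by (simp add: M_eq alive_eq eigfun_0[OF a])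
  then show ?case
    using measure_atom_0[OF prob_space_srw sets_srw AE_srw_start]
      measure_atom_0[OF walk.prob_space_law walk.sets_law walk.AE_law_start,
        OF walk_biased walk_biased walk_biased]
    by (simp add: transformed_law_def)
next
  case (Suc n)
  let ?d = "X (Suc n) w - X n w"
  have "measure (transformed_law a) (atom (Suc n) w)
    = measure (transformed_law a) (atom n w) * \<P>(u in unit_uniform. biased_step a (X n w) u = ?d)"
    using walk.measure_law_step[OF walk_biased[of a] sets_atom[of n w], of "X n w" ?d]
    unfolding transformed_law_def atom_Suc .
  also have "\<dots> = M a (Suc n) w * (measure srw (atom n w) / 2)"
    using M_step[OF w, of n] by (simp add: Suc.IH)
  also have "measure srw (atom n w) / 2 = measure srw (atom (Suc n) w)"
    using measure_srw_step[OF sets_atom[of n w], of ?d "X n w"] X_Suc_cases[OF w, of n]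
    unfolding atom_Suc by auto
  finally show ?case .
qed

lemma Q_law_transformed_law: "Q_law a (transformed_law a)"
  unfolding Q_law_def
proof (intro conjI allI ballI)
  show P: "prob_space (transformed_law a)" and S: "sets (transformed_law a) = sets F_inf"
    using walk.prob_space_law[OF walk_biased] walk.sets_law[OF walk_biased]
    by (simp_all add: transformed_law_def)
  interpret Q: prob_space "transformed_law a" by (rule P)
  fix n \<Lambda> assume \<Lambda>: "\<Lambda> \<in> sets (F n)"
  let ?N = "density srw (\<lambda>\<omega>. ennreal (M a n \<omega>))"
  have N: "emeasure ?N A = ennreal (\<integral>\<omega>. indicator A \<omega> * M a n \<omega> \<partial>srw)" if "A \<in> sets (F n)" for A
  proof -
    have "emeasure ?N A = (\<integral>\<^sup>+\<omega>. ennreal (M a n \<omega>) * indicator A \<omega> \<partial>srw)"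
      using sets_F_srw[OF that] by (subst emeasure_density) auto
    also have "\<dots> = (\<integral>\<^sup>+\<omega>. ennreal (indicator A \<omega> * M a n \<omega>) \<partial>srw)"
      by (intro nn_integral_cong) (auto simp: indicator_def)
    also have "\<dots> = ennreal (\<integral>\<omega>. indicator A \<omega> * M a n \<omega> \<partial>srw)"
      using M_nonneg by (intro nn_integral_eq_integral integrable_indicator_M[OF that]) auto
    finally show ?thesis .
  qed
  have "emeasure (transformed_law a) \<Lambda> = emeasure ?N \<Lambda>"
  proof (rule emeasure_eqI_atoms[OF S _ _ \<Lambda>])
    fix w assume w: "w \<in> paths"
    \<comment> \<open>\<open>M a n\<close> reads only coordinates up to \<open>n\<close>, so it is
      constant on the atom.\<close>
    have "(\<integral>\<omega>. indicator (atom n w) \<omega> * M a n \<omega> \<partial>srw)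
        = (\<integral>\<omega>. indicator (atom n w) \<omega> * M a n w \<partial>srw)"
      using w by (intro Bochner_Integration.integral_cong)
        (auto simp: indicator_def M_eq alive_eq atom_def)
    also have "\<dots> = M a n w * measure srw (atom n w)"
      using sets_F_subset_paths[OF sets_atom[of n w]] by (simp add: Int_absorb2)
    finally show "emeasure (transformed_law a) (atom n w) = emeasure ?N (atom n w)"
      unfolding N[OF sets_atom]
      by (simp add: Q.emeasure_eq_measure measure_transformed_atom[OF w])
  qed simp
  then show "measure (transformed_law a) \<Lambda> = (\<integral>\<omega>. indicator \<Lambda> \<omega> * M a n \<omega> \<partial>srw)"
    unfolding N[OF \<Lambda>] Q.emeasure_eq_measure
    using M_nonneg by (subst (asm) ennreal_inj) (auto intro!: Bochner_Integration.integral_nonneg)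
qed

text \<open>Agreement on every \<open>F n\<close> forces equality on \<open>F_inf\<close>, so claims
  about all such \<open>Q\<close> reduce to one explicit Markov law.\<close>

lemma Q_law_iff: "Q_law a Q \<longleftrightarrow> Q = transformed_law a"
proof
  assume "Q_law a Q"
  then show "Q = transformed_law a"
    using Q_law_transformed_law unfolding Q_law_def
    by (intro measure_eqI_F) (auto simp: prob_space_def)
qed (simp add: Q_law_transformed_law)

lemma transformed_law_transition:
  assumes "measure (transformed_law a) {\<omega> \<in> space (transformed_law a). X n \<omega> = k} > 0"
  shows "\<P>(\<omega> in transformed_law a. X (Suc n) \<omega> = k + d \<bar> X n \<omega> = k)
    = \<P>(u in unit_uniform. biased_step a k u = d)"
proof -
  have sp: "space (transformed_law a) = paths"
    by (simp add: transformed_law_def walk.space_law[OF walk_biased])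
  have "measure (transformed_law a) {\<omega> \<in> paths. X n \<omega> = k \<and> X (Suc n) \<omega> = k + d}
    = measure (transformed_law a) {\<omega> \<in> paths. X n \<omega> = k} * \<P>(u in unit_uniform. biased_step a k u = d)"
    using walk.measure_law_step[OF walk_biased paths_in_sets_F] by (simp add: transformed_law_def)
  moreover have "{\<omega> \<in> paths. X n \<omega> = k \<and> X (Suc n) \<omega> = k + d}
    = {\<omega> \<in> paths. X (Suc n) \<omega> = k + d \<and> X n \<omega> = k}" by auto
  ultimately show ?thesis
    using assms by (simp add: cond_prob_def sp)
qed

end

theorem theorem1p5:
  fixes a :: int
  assumes "a \<ge> 2"
  shows
    "(\<forall>n. \<forall>\<Lambda> \<in> sets (F n).
        (\<lambda>p. (\<integral>\<omega>. indicator (\<Lambda> \<inter> {\<omega> \<in> paths. S_star p \<omega> < a}) \<omega> \<partial>srw)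
             / (\<integral>\<omega>. indicator {\<omega> \<in> paths. S_star p \<omega> < a} \<omega> \<partial>srw) :: real)
        \<longlonglongrightarrow> (\<integral>\<omega>. indicator (\<Lambda> \<inter> {\<omega> \<in> paths. S_star n \<omega> < a}) \<omega> * M a n \<omega> \<partial>srw))
     \<and> (\<forall>n. \<forall>\<omega> \<in> paths. 0 \<le> M a n \<omega>)
     \<and> martingale srw F (M a)
     \<and> \<not> uniformly_integrable srw (M a)
     \<and> (\<exists>!Q. Q_law a Q)
     \<and> (\<forall>Q. Q_law a Q \<longrightarrow>
         (\<forall>n. \<forall>k \<in> {- a + 1 .. a - 1}. measure Q {\<omega> \<in> space Q. X n \<omega> = k} > 0 \<longrightarrow>
            \<P>(\<omega> in Q. X (Suc n) \<omega> = k + 1 \<bar> X n \<omega> = k)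
              = sin (real_of_int (a - k - 1) / (2 * real_of_int a) * pi)
                / (2 * cos (pi / (2 * real_of_int a))
                     * sin (real_of_int (a - k) / (2 * real_of_int a) * pi))
          \<and> \<P>(\<omega> in Q. X (Suc n) \<omega> = k - 1 \<bar> X n \<omega> = k)
              = sin (real_of_int (a - k + 1) / (2 * real_of_int a) * pi)
                / (2 * cos (pi / (2 * real_of_int a))
                     * sin (real_of_int (a - k) / (2 * real_of_int a) * pi))))"
  \<comment> \<open>After this rewriting, existence and uniqueness of \<open>Q\<close> is the
    triviality that exactly one measure equals \<open>transformed_law a\<close>.\<close>
  unfolding alive_def[symmetric] Q_law_iff[OF assms]
proof (intro conjI allI ballI impI)
  fix n \<Lambda> assume "\<Lambda> \<in> sets (F n)"
  moreover from this have "\<Lambda> \<inter> alive a p \<inter> paths = \<Lambda> \<inter> alive a p" "alive a p \<inter> paths = alive a p" for p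
    by (auto simp: alive_def)
  ultimately show "(\<lambda>p. (\<integral>\<omega>. indicator (\<Lambda> \<inter> alive a p) \<omega> \<partial>srw) / (\<integral>\<omega>. indicator (alive a p) \<omega> \<partial>srw) :: real)
        \<longlonglongrightarrow> (\<integral>\<omega>. indicator (\<Lambda> \<inter> alive a n) \<omega> * M a n \<omega> \<partial>srw)"
    using conditioned_measure_tendsto[OF assms] by simp
next
  fix Q n k
  assume Q: "Q = transformed_law a" and k: "k \<in> {- a + 1 .. a - 1}"
    and pos: "measure Q {\<omega> \<in> space Q. X n \<omega> = k} > 0"
  have "\<bar>k\<bar> < a" using k by auto
  note eig = eigfun_eq[OF assms, unfolded mult.commute[of pi]]
  have h: "eigfun a k = sin (real_of_int (a - k) / (2 * real_of_int a) * pi)"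
    "eigfun a (k + 1) = sin (real_of_int (a - k - 1) / (2 * real_of_int a) * pi)"
    "eigfun a (k - 1) = sin (real_of_int (a - k + 1) / (2 * real_of_int a) * pi)"
    using \<open>\<bar>k\<bar> < a\<close> by (auto simp: eig algebra_simps)
  have "\<P>(\<omega> in Q. X (Suc n) \<omega> = k + 1 \<bar> X n \<omega> = k) = up_prob a k"
    using transformed_law_transition[OF assms pos[unfolded Q], of 1]
    by (simp only: Q prob_biased_step[OF assms])
  then show "\<P>(\<omega> in Q. X (Suc n) \<omega> = k + 1 \<bar> X n \<omega> = k)
      = sin (real_of_int (a - k - 1) / (2 * real_of_int a) * pi)
        / (2 * cos (pi / (2 * real_of_int a)) * sin (real_of_int (a - k) / (2 * real_of_int a) * pi))"
    using \<open>\<bar>k\<bar> < a\<close> by (simp only: up_prob_def h[symmetric] eigval_def[symmetric] if_True)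
  have "\<P>(\<omega> in Q. X (Suc n) \<omega> = k - 1 \<bar> X n \<omega> = k) = 1 - up_prob a k"
    using transformed_law_transition[OF assms pos[unfolded Q], of "- 1"]
    by (simp only: Q prob_biased_step[OF assms] diff_conv_add_uminus)
  then show "\<P>(\<omega> in Q. X (Suc n) \<omega> = k - 1 \<bar> X n \<omega> = k)
      = sin (real_of_int (a - k + 1) / (2 * real_of_int a) * pi)
        / (2 * cos (pi / (2 * real_of_int a)) * sin (real_of_int (a - k) / (2 * real_of_int a) * pi))"
    by (simp only: down_prob[OF assms \<open>\<bar>k\<bar> < a\<close>] h[symmetric] eigval_def[symmetric])
qed (use assms in \<open>auto intro: M_nonneg martingale_M dest: not_uniformly_integrable_M\<close>)

end
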